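(* Let $f\colon S^1\to S^1$ be a piecewise-linear homeomorphism of the circle. Then $f$ induces a dyadic rearrangement of the basilica (that is, $f\in T_B$) if and only if it satisfies the following requirements: (1) the equivalence relation $\sim$ on the circle defined by the basilica lamination is invariant under $f$; (2) every breakpoint of $f$ is the endpoint of an arc in the basilica lamination. In particular, $T_B$ forms a group under composition.
   Context: Identify the unit circle $S^1$ with $\mathbb{R}/\mathbb{Z}$. Piecewise-linear means with finitely many linear pieces; breakpoints are the points where the derivative jumps. An arc $\{a,b\}$ is a hyperbolic geodesic of the closed unit disk joining two distinct points $a,b\in S^1$. The basilica lamination consists of the closed unit disk together with the arc $\{1/3,2/3\}$ and all arcs joining $\frac{k}{2^{n}}-\frac{1}{3\cdot 2^{n+1}}$ and $\frac{k}{2^{n}}+\frac{1}{3\cdot 2^{n+1}}$, for $k\in\mathbb{Z}$ and integers $n\ge 0$. The equivalence relation $\sim$ it defines on $S^1$ identifies the two endpoints of each arc (and no other distinct points); the quotient of $S^1$ by $\sim$ is the basilica, i.e. the Julia set of $z^2-1$. Invariance of $\sim$ under $f$ means that $\theta\sim\theta'$ if and only if $f(\theta)\sim f(\theta')$. The primary arc of a closed interval $[a,b]$ of the circle is the arc joining $a+\tfrac14(b-a)$ and $b-\tfrac14(b-a)$ (so it cuts the interval into three pieces with length ratio $1:2:1$). Arc diagrams: start with the two arcs $\{1/3,2/3\}$ and $\{1/6,5/6\}$, whose endpoints divide the circle into the four intervals $[1/6,1/3]$, $[1/3,2/3]$, $[2/3,5/6]$, $[-1/6,1/6]$. Finitely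 many times (possibly zero), choose one of the current intervals and add its primary arc, which replaces that interval by three intervals. Any finite collection of arcs obtained this way is an arc diagram. It is regarded as a 2-complex on the closed disk: the vertices are the arc endpoints, the edges are the arcs and the circle intervals between consecutive endpoints, and the faces are the complementary regions. Two arc diagrams are isomorphic if there is an orientation-preserving isomorphism between these 2-complexes (so circle intervals go to circle intervals and arcs to arcs). Given an isomorphism $\varphi\colon\mathcal{D}\to\mathcal{R}$ of arc diagrams, one defines a piecewise-linear homeomorphism $S^1\to S^1$ by sending each interval of $\mathcal{D}$ linearly (preserving orientation) onto the corresponding interval of $\mathcal{R}$. Such a homeomorphism preserves $\sim$, hence acts as a self-homeomorphism of the basilica, and is called a dyadic rearrangement of the basilica. $T_B$ is the set of all dyadic rearrangements of the basilica.
   Formalization: The homeomorphism f is additionally assumed to preserve orientation; without this the claim fails, since θ ↦ −θ is piecewise linear, has no breakpoints and preserves ∼, but is not a dyadic rearrangement. *)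

theory Defs
  imports "HOL-Analysis.Analysis" "HOL-Algebra.Group"
begin

section \<open>The circle\<close>

quotient_type circle = real / "\<lambda>x y :: real. x - y \<in> \<int>"
  morphisms rep_circle circ
proof (rule equivpI)
  show "reflp (\<lambda>x y :: real. x - y \<in> \<int>)"
    by (simp add: reflp_def)
  show "symp (\<lambda>x y :: real. x - y \<in> \<int>)"
  proof (rule sympI)
    fix x y :: real
    assume "x - y \<in> \<int>"
    then have "- (x - y) \<in> \<int>" by (rule Ints_minus)
    then show "y - x \<in> \<int>" by simp
  qed
  show "transp (\<lambda>x y :: real. x - y \<in> \<int>)"
  proof (rule transpI)
    fix x y z :: real
    assume "x - y \<in> \<int>" "y - z \<in> \<int>"
    then have "(x - y) + (y - z) \<in> \<int>" by (rule Ints_add)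
    then show "x - z \<in> \<int>" by simp
  qed
qed

text \<open>The type carries the quotient topology of the real line.\<close>

instantiation circle :: topological_space
begin

definition open_circle :: "circle set \<Rightarrow> bool" where
  "open_circle U \<longleftrightarrow> open (circ -` U)"

instance
proof
  show "open (UNIV :: circle set)"
    by (simp add: open_circle_def)
  show "open (S \<inter> T)" if "open S" "open T" for S T :: "circle set"
    using that by (simp add: open_circle_def vimage_Int open_Int)
  show "open (\<Union>K)" if "\<forall>S\<in>K. open S" for K :: "circle set set"
    using that unfolding open_circle_def vimage_Union by (rule open_UN)
qed

end

section \<open>Piecewise-linear homeomorphisms of the circle\<close>

definition is_lift :: "(real \<Rightarrow> real) \<Rightarrow> (circle \<Rightarrow> circle) \<Rightarrow> bool" where
  "is_lift F f \<longleftrightarrow> continuous_on UNIV F \<and> (\<forall>x. f (circ x) = circ (F x))"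

definition piecewise_linear :: "(circle \<Rightarrow> circle) \<Rightarrow> bool" where
  "piecewise_linear f \<longleftrightarrow>
     (\<exists>F n t. is_lift F f \<and> t 0 = 0 \<and> t n = 1 \<and>
        (\<forall>i<n. t i < t (Suc i) \<and>
           (\<exists>m c. \<forall>x\<in>{t i..t (Suc i)}. F x = m * x + c)))"

definition pl_homeomorphism :: "(circle \<Rightarrow> circle) \<Rightarrow> bool" where
  "pl_homeomorphism f \<longleftrightarrow> (\<exists>g. homeomorphism UNIV UNIV f g) \<and> piecewise_linear f"

text \<open>Homeomorphisms of the circle are understood to preserve the orientation: the reflection
  \<open>x \<mapsto> - x\<close> has no breakpoints and preserves the lamination, but it is not a dyadic
  rearrangement.\<close>

definition orientation_preserving :: "(circle \<Rightarrow> circle) \<Rightarrow> bool" where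
  "orientation_preserving f \<longleftrightarrow> (\<exists>F. is_lift F f \<and> strict_mono F)"

text \<open>Two lifts of a map differ by an integer constant, so the choice of the lift
  and of the representative does not matter here.\<close>

definition breakpoint :: "(circle \<Rightarrow> circle) \<Rightarrow> circle \<Rightarrow> bool" where
  "breakpoint f p \<longleftrightarrow>
     (\<exists>F x l r. is_lift F f \<and> circ x = p \<and> l \<noteq> r \<and>
        (F has_real_derivative l) (at_left x) \<and>
        (F has_real_derivative r) (at_right x))"

section \<open>The basilica lamination\<close>

text \<open>A hyperbolic geodesic of the closed disk is determined by its two endpoints on
  the circle; an arc is represented by the set of its two endpoints.\<close>

definition basilica_lamination :: "circle set set" where
  "basilica_lamination =
     insert {circ (1/3), circ (2/3)}
       {{circ (of_int k / 2 ^ n - 1 / (3 * 2 ^ (n + 1))),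
         circ (of_int k / 2 ^ n + 1 / (3 * 2 ^ (n + 1)))} | (k :: int) (n :: nat). True}"

definition basilica_rel :: "circle \<Rightarrow> circle \<Rightarrow> bool" where
  "basilica_rel p q \<longleftrightarrow> p = q \<or> {p, q} \<in> basilica_lamination"

definition preserves_basilica_rel :: "(circle \<Rightarrow> circle) \<Rightarrow> bool" where
  "preserves_basilica_rel f \<longleftrightarrow>
     (\<forall>p q. basilica_rel p q \<longleftrightarrow> basilica_rel (f p) (f q))"

section \<open>Arc diagrams\<close>

text \<open>An arc diagram is given by its set of arcs; its vertices are the elements of
  \<open>\<Union>D\<close>. The circle intervals between consecutive vertices are described by real
  representatives \<open>a < b\<close>, which are unique up to a common integer translation.\<close>

definition circle_interval :: "circle set set \<Rightarrow> real \<Rightarrow> real \<Rightarrow> bool" where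
  "circle_interval D a b \<longleftrightarrow>
     a < b \<and> circ a \<in> \<Union>D \<and> circ b \<in> \<Union>D \<and> (\<forall>x. a < x \<and> x < b \<longrightarrow> circ x \<notin> \<Union>D)"

definition primary_arc :: "real \<Rightarrow> real \<Rightarrow> circle set" where
  "primary_arc a b = {circ (a + (b - a) / 4), circ (b - (b - a) / 4)}"

inductive arc_diagram :: "circle set set \<Rightarrow> bool" where
  base: "arc_diagram {{circ (1/3), circ (2/3)}, {circ (1/6), circ (5/6)}}"
| step: "arc_diagram D \<Longrightarrow> circle_interval D a b \<Longrightarrow> arc_diagram (insert (primary_arc a b) D)"

text \<open>The circle edges, directed counterclockwise. Every arc diagram has at least four
  vertices, so an interval is determined by its ordered pair of endpoints.\<close>

definition circle_edges :: "circle set set \<Rightarrow> (circle \<times> circle) set" where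
  "circle_edges D = {(circ a, circ b) | a b. circle_interval D a b}"

text \<open>The arcs of a diagram are pairwise disjoint, so the boundary of each complementary
  region of the disk alternates between circle edges and arcs, and the region is
  determined by the circle edges on its boundary. Two circle edges bound the same region
  if and only if no arc separates them, i.e. if and only if for every arc their midpoints
  lie in the same component of the circle minus the two endpoints of the arc.\<close>

definition same_face :: "circle set set \<Rightarrow> circle \<Rightarrow> circle \<Rightarrow> bool" where
  "same_face D p q \<longleftrightarrow> (\<forall>A\<in>D. connected_component (- A) p q)"

definition faces :: "circle set set \<Rightarrow> (circle \<times> circle) set set" where
  "faces D =
     {{(circ c, circ d) | c d. circle_interval D c d \<and>
          same_face D (circ ((a + b) / 2)) (circ ((c + d) / 2))} | a b. circle_interval D a b}"

text \<open>An isomorphism of the 2-complexes, given by its action on the vertices: arcs go to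
  arcs, circle edges to circle edges, faces to faces. It is orientation preserving because
  it respects the counterclockwise direction of the circle edges.\<close>

definition diagram_isomorphism ::
    "(circle \<Rightarrow> circle) \<Rightarrow> circle set set \<Rightarrow> circle set set \<Rightarrow> bool" where
  "diagram_isomorphism \<phi> D R \<longleftrightarrow>
     bij_betw \<phi> (\<Union>D) (\<Union>R) \<and>
     (\<lambda>A. \<phi> ` A) ` D = R \<and>
     map_prod \<phi> \<phi> ` circle_edges D = circle_edges R \<and>
     (\<lambda>E. map_prod \<phi> \<phi> ` E) ` faces D = faces R"

definition induced_by ::
    "(circle \<Rightarrow> circle) \<Rightarrow> (circle \<Rightarrow> circle) \<Rightarrow> circle set set \<Rightarrow> circle set set \<Rightarrow> bool" where
  "induced_by f \<phi> D R \<longleftrightarrow>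
     (\<forall>a b c d. circle_interval D a b \<and> circle_interval R c d \<and>
        \<phi> (circ a) = circ c \<and> \<phi> (circ b) = circ d \<longrightarrow>
        (\<forall>t\<in>{0..1}. f (circ (a + t * (b - a))) = circ (c + t * (d - c))))"

definition T_B :: "(circle \<Rightarrow> circle) set" where
  "T_B = {f. \<exists>D R \<phi>. arc_diagram D \<and> arc_diagram R \<and>
              diagram_isomorphism \<phi> D R \<and> induced_by f \<phi> D R}"

end

theory Submission
  imports Defs
begin

text \<open>
  \<^bold>\<open>Arithmetic of the lamination.\<close> All arcs of the basilica lamination are given by one formula: the
  arcs of level \<open>m \<ge> 0\<close> join \<open>(6 k - 1) / (3 \<cdot> 2\<^sup>m)\<close> to \<open>(6 k + 1) / (3 \<cdot> 2\<^sup>m)\<close>, and level \<open>0\<close> is the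
  arc \<open>{1/3, 2/3}\<close>. The endpoints of the arcs of level at most \<open>N\<close> are the points
  \<open>j / (3 \<cdot> 2\<^sup>N)\<close> with \<open>3\<close> not dividing \<open>j\<close>, and each of them lies on a single arc.

  Call \<open>[(3 c - 1) / (3 \<cdot> 2\<^sup>m), (3 c + 1) / (3 \<cdot> 2\<^sup>m)]\<close> with \<open>m \<ge> 1\<close> a standard interval. The
  increasing affine map between two standard intervals carries the arcs with endpoints inside the
  first one to arcs of the lamination (\<open>standard_to_standard_arc\<close>). Conversely, an interval shorter
  than the circle whose primary arc is an arc of the lamination of level at least \<open>2\<close> is standard
  (\<open>arc_ratio_imp_standard\<close>): the ratio 1:2:1 lets the arc determine the interval.

  \<^bold>\<open>Arc diagrams.\<close> A finite set of arcs of the lamination that contains the arcs of level \<open>0\<close> and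
  \<open>1\<close> is an arc diagram if and only if it cuts the circle into standard intervals
  (\<open>arc_diagram_imp_standard\<close>, \<open>arc_diagramI\<close>). For sufficiency, an arc of the highest
  level is the primary arc of the interval that appears when the arc is removed
  (\<open>innermost_arc_removal\<close>), so the construction can be undone one arc at a time. In
  particular all arcs of level at most \<open>N \<ge> 1\<close> together form an arc diagram.

  \<^bold>\<open>The equivalence.\<close> A rearrangement given by diagrams \<open>D\<close> and \<open>R\<close> maps the arcs of \<open>D\<close> to arcs of
  \<open>R\<close>, and it maps every other arc of the lamination to an arc because it is affine between standard
  intervals; the same holds for its inverse. Its breakpoints are vertices of \<open>D\<close>. Conversely, let
  \<open>f\<close> preserve the relation and have its breakpoints among the endpoints of arcs. Let \<open>D\<close> consist of all
  arcs of level at most \<open>N\<close>, with \<open>N\<close> so large that all breakpoints are vertices of \<open>D\<close> and that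
  \<open>f\<close> maps some arcs of \<open>D\<close> to the arcs of level \<open>0\<close> and \<open>1\<close>. Then \<open>f\<close> is affine on every interval of
  \<open>D\<close>, so it maps the primary arc of the interval, which is not in \<open>D\<close>, to the primary arc of the
  image; the latter is an arc of the lamination of level at least \<open>2\<close>, hence the image is standard.
  So \<open>f\<close> maps \<open>D\<close> to an arc diagram, and \<open>f\<close> is a rearrangement.

  \<^bold>\<open>The group.\<close> The predicate \<open>basilica_map\<close> states the criterion in terms of a
  lift to the line that is affine between the points of a finite set of arc endpoints. It agrees
  with membership in \<open>T_B\<close> and is visibly closed under composition and inverses.
\<close>

section \<open>Points of the circle\<close>

lemma circ_eq_iff: "circ x = circ y \<longleftrightarrow> x - y \<in> \<int>"
  by (rule circle.abs_eq_iff)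

lemma circ_cases: obtains x where "p = circ x"
  by (metis Quotient_circle Quotient_abs_rep)

lemma circ_add_int [simp]: "circ (x + of_int k) = circ x"
  by (simp add: circ_eq_iff)

lemma circ_add_one [simp]: "circ (x + 1) = circ x"
  by (simp add: circ_eq_iff)

lemma circ_eqE:
  assumes "circ x = circ y"
  obtains k :: int where "x = y + of_int k"
proof -
  from assms obtain k :: int where "x - y = of_int k"
    unfolding circ_eq_iff by (rule Ints_cases)
  then show ?thesis using that by (simp add: algebra_simps)
qed

section \<open>The lamination by levels\<close>

definition basilica_arc :: "int \<Rightarrow> nat \<Rightarrow> circle set" where
  "basilica_arc k m = {circ (of_int (6 * k - 1) / (3 * 2 ^ m)), circ (of_int (6 * k + 1) / (3 * 2 ^ m))}"

text \<open>At level \<open>0\<close> the two endpoints differ by \<open>2/3\<close>, so the shorter side of this arc is the one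
  outside of the two given representatives. This is why level \<open>0\<close> is exceptional in arguments
  about lengths.\<close>
lemma basilica_arc_0: "basilica_arc k 0 = {circ (1/3), circ (2/3)}"
proof -
  have "circ (of_int (6 * k - 1) / 3) = circ (2/3 + of_int (2 * k - 1))"
    by (rule arg_cong[of _ _ circ]) (simp add: field_simps)
  moreover have "circ (of_int (6 * k + 1) / 3) = circ (1/3 + of_int (2 * k))"
    by (rule arg_cong[of _ _ circ]) (simp add: field_simps)
  ultimately show ?thesis
    unfolding basilica_arc_def circ_add_int by (simp add: insert_commute)
qed

lemma basilica_lamination_eq: "basilica_lamination = {basilica_arc k m | k m. True}"
proof -
  have S: "basilica_arc k (Suc n) = {circ (of_int k / 2 ^ n - 1 / (3 * 2 ^ (n + 1))),
         circ (of_int k / 2 ^ n + 1 / (3 * 2 ^ (n + 1)))}" for k n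
  proof -
    have "of_int k / 2 ^ n - 1 / (3 * 2 ^ (n + 1)) = (of_int (6 * k - 1) / (3 * 2 ^ Suc n) :: real)"
      and "of_int k / 2 ^ n + 1 / (3 * 2 ^ (n + 1)) = (of_int (6 * k + 1) / (3 * 2 ^ Suc n) :: real)"
      by (simp_all add: field_simps)
    then show ?thesis unfolding basilica_arc_def by simp
  qed
  have "{basilica_arc k m | k m. True} = {basilica_arc k 0 | k. True} \<union> {basilica_arc k (Suc n) | k n. True}"
    by (auto; metis not0_implies_Suc)
  also have "\<dots> = basilica_lamination"
    unfolding basilica_lamination_def S basilica_arc_0 by auto
  finally show ?thesis by simp
qed

lemma three_dvd_mult_power_two [simp]: "3 dvd (a :: int) * 2 ^ i \<longleftrightarrow> 3 dvd a"
  by (rule coprime_dvd_mult_left_iff) simp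

text \<open>Equality of two points with denominators \<open>3 \<cdot> 2\<^sup>m\<close> and \<open>3 \<cdot> 2\<^bsup>m'\<^esup>\<close> becomes an equation between
  integers, where parity and divisibility by \<open>3\<close> can be used.\<close>
lemma circ_grid_eqE:
  fixes p q :: int
  assumes "circ (of_int p / (3 * 2 ^ m)) = circ (of_int q / (3 * 2 ^ m'))" "m \<le> m'"
  obtains t :: int where "p * 2 ^ (m' - m) = q + 3 * 2 ^ m' * t"
proof -
  from assms(1) obtain t :: int where
    t: "of_int p / (3 * 2 ^ m) = of_int q / (3 * 2 ^ m') + (of_int t :: real)"
    by (rule circ_eqE)
  have e: "(2::real) ^ m' = 2 ^ (m' - m) * 2 ^ m"
    using assms(2) by (simp flip: power_add)
  from t have "real_of_int p * 2 ^ (m' - m) = of_int q + 3 * 2 ^ m' * of_int t"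
    unfolding e by (simp add: field_simps)
  then have "real_of_int (p * 2 ^ (m' - m)) = of_int (q + 3 * 2 ^ m' * t)"
    by simp
  then have "p * 2 ^ (m' - m) = q + 3 * 2 ^ m' * t"
    by (simp only: of_int_eq_iff)
  then show ?thesis by (rule that)
qed

text \<open>Treats the two endpoints of an arc uniformly, by a sign \<open>e\<close>.\<close>
lemma basilica_arc_memE:
  assumes "p \<in> basilica_arc k m"
  obtains e :: int where "e = 1 \<or> e = -1" "p = circ (of_int (6 * k + e) / (3 * 2 ^ m))"
    "basilica_arc k m = {circ (of_int (6 * k + e) / (3 * 2 ^ m)), circ (of_int (6 * k - e) / (3 * 2 ^ m))}"
proof (cases "p = circ (of_int (6 * k + 1) / (3 * 2 ^ m))")
  case True
  show ?thesis by (rule that[of 1]) (use True in \<open>auto simp: basilica_arc_def\<close>)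
next
  case False
  show ?thesis by (rule that[of "-1"]) (use False assms in \<open>auto simp: basilica_arc_def\<close>)
qed

text \<open>The numerators \<open>6 k \<plusminus> 1\<close> are odd, so the power of two in the denominator, and with it the
  level, can be read off from the point; the residue of the numerator modulo \<open>3\<close> then tells the
  two endpoints of an arc apart.\<close>
lemma arcs_disjoint_aux:
  assumes "p \<in> basilica_arc k m" "p \<in> basilica_arc k' m'" "m \<le> m'"
  shows "m = m' \<and> basilica_arc k m = basilica_arc k' m'"
proof -
  obtain e where e: "e = 1 \<or> e = -1" "p = circ (of_int (6 * k + e) / (3 * 2 ^ m))"
    "basilica_arc k m = {circ (of_int (6 * k + e) / (3 * 2 ^ m)), circ (of_int (6 * k - e) / (3 * 2 ^ m))}"
    using assms(1) by (rule basilica_arc_memE)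
  obtain d where d: "d = 1 \<or> d = -1" "p = circ (of_int (6 * k' + d) / (3 * 2 ^ m'))"
    "basilica_arc k' m' = {circ (of_int (6 * k' + d) / (3 * 2 ^ m')), circ (of_int (6 * k' - d) / (3 * 2 ^ m'))}"
    using assms(2) by (rule basilica_arc_memE)
  obtain t :: int where t: "(6 * k + e) * 2 ^ (m' - m) = 6 * k' + d + 3 * 2 ^ m' * t"
    using circ_grid_eqE e(2) d(2) assms(3) by metis
  have mm: "m = m'"
  proof (rule ccontr)
    assume "m \<noteq> m'"
    with assms(3) have pos: "m' - m > 0" "m' > 0" by auto
    have "even ((6 * k + e) * 2 ^ (m' - m))" "even (3 * 2 ^ m' * t)"
      using pos by simp_all
    then have "even (6 * k' + d)" using t by (metis even_add)
    with d(1) show False by auto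
  qed
  have "6 * k + e = 6 * k' + d + 3 * (2 ^ m' * t)" using t mm by simp
  with e(1) d(1) have ed: "e = d" by presburger
  have "circ (of_int (6 * k - e) / (3 * 2 ^ m)) = circ (of_int (6 * k' - d) / (3 * 2 ^ m) + of_int t)"
  proof (rule arg_cong[of _ _ circ])
    have "6 * k - e = 6 * k' - d + 3 * 2 ^ m * t" using t mm ed by simp
    then have "real_of_int (6 * k - e) = of_int (6 * k' - d + 3 * 2 ^ m * t)" by simp
    then show "real_of_int (6 * k - e) / (3 * 2 ^ m) = of_int (6 * k' - d) / (3 * 2 ^ m) + of_int t"
      by (simp add: field_simps)
  qed
  then have "circ (of_int (6 * k - e) / (3 * 2 ^ m)) = circ (of_int (6 * k' - d) / (3 * 2 ^ m'))"
    unfolding circ_add_int mm .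
  with e d mm show ?thesis by simp
qed

lemma arcs_disjoint:
  assumes "p \<in> basilica_arc k m" "p \<in> basilica_arc k' m'"
  shows "m = m'" "basilica_arc k m = basilica_arc k' m'"
  using arcs_disjoint_aux[OF assms] arcs_disjoint_aux[OF assms(2,1)] by (metis nle_le)+

lemma lamination_disjoint:
  assumes "A \<in> basilica_lamination" "A' \<in> basilica_lamination" "p \<in> A" "p \<in> A'"
  shows "A = A'"
  using assms arcs_disjoint(2) unfolding basilica_lamination_eq by blast

lemma arc_ends_distinct:
  "circ (of_int (6 * k - 1) / (3 * 2 ^ m)) \<noteq> circ (of_int (6 * k + 1) / (3 * 2 ^ m))"
proof
  assume "circ (of_int (6 * k - 1) / (3 * 2 ^ m)) = circ (of_int (6 * k + 1) / (3 * 2 ^ m))"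
  then obtain t :: int where "(6 * k - 1) * 2 ^ (m - m) = 6 * k + 1 + 3 * 2 ^ m * t"
    by (rule circ_grid_eqE) simp
  then have "(- 2 :: int) = 3 * (2 ^ m * t)" by simp
  then show False by presburger
qed

lemma lamination_doubleton:
  assumes "A \<in> basilica_lamination" "p \<in> A"
  obtains q where "A = {p, q}" "p \<noteq> q"
proof -
  obtain k m where A: "A = basilica_arc k m" using assms(1) unfolding basilica_lamination_eq by auto
  show ?thesis
    using that assms(2) arc_ends_distinct[of k m] unfolding A basilica_arc_def by (auto simp: insert_commute)
qed

text \<open>Describes the endpoints of arcs by the relation alone, so that a bijection preserving the
  relation also preserves the set of endpoints.\<close>
lemma mem_lamination_iff: "p \<in> \<Union>basilica_lamination \<longleftrightarrow> (\<exists>q. q \<noteq> p \<and> basilica_rel p q)"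
  unfolding basilica_rel_def by (metis UnionE UnionI insertI1 lamination_doubleton)

definition arcs_upto :: "nat \<Rightarrow> circle set set" where
  "arcs_upto N = {basilica_arc k m | k m. m \<le> N}"

lemma arcs_upto_mono: "M \<le> N \<Longrightarrow> arcs_upto M \<subseteq> arcs_upto N"
  unfolding arcs_upto_def using le_trans by blast

lemma arc_in_arcs_upto_iff: "basilica_arc k m \<in> arcs_upto N \<longleftrightarrow> m \<le> N"
proof
  assume "basilica_arc k m \<in> arcs_upto N"
  then obtain k' m' where "basilica_arc k m = basilica_arc k' m'" "m' \<le> N"
    unfolding arcs_upto_def by blast
  then show "m \<le> N" using arcs_disjoint(1)[of _ k m k' m'] unfolding basilica_arc_def by blast
qed (auto simp: arcs_upto_def)

lemma arcs_upto_subset: "arcs_upto N \<subseteq> basilica_lamination"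
  unfolding arcs_upto_def basilica_lamination_eq by blast

lemma finite_lamination_subset_arcs_upto:
  assumes "finite S" "S \<subseteq> basilica_lamination"
  obtains N where "S \<subseteq> arcs_upto N"
proof -
  have "\<exists>N. S \<subseteq> arcs_upto N"
    using assms
  proof (induction S)
    case empty
    then show ?case by simp
  next
    case (insert A S)
    then obtain N where N: "S \<subseteq> arcs_upto N" by auto
    obtain k m where A: "A = basilica_arc k m" using insert.prems unfolding basilica_lamination_eq by auto
    have "insert A S \<subseteq> arcs_upto (max N m)"
      using N arcs_upto_mono[of N "max N m"] unfolding A by (auto simp: arc_in_arcs_upto_iff)
    then show ?case by blast
  qed
  then show ?thesis using that by blast
qed

text \<open>Cancelling factors of two from the numerator lowers the level until the numerator is odd,
  hence of the form \<open>6 k \<plusminus> 1\<close>; at level \<open>0\<close> an even numerator is made odd by adding \<open>\<plusminus>3\<close>, a full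
  turn.\<close>
lemma grid_mem_arcs_upto:
  fixes m :: int
  assumes "\<not> 3 dvd m"
  shows "circ (of_int m / (3 * 2 ^ N)) \<in> \<Union>(arcs_upto N)"
  using assms
proof (induction N arbitrary: m)
  case 0
  have "m mod 6 = 1 \<or> m mod 6 = 5 \<or> m mod 6 = 2 \<or> m mod 6 = 4"
    using 0 by presburger
  moreover have "of_int m / (3 * 2 ^ 0) = real_of_int (m - 3 * t) / (3 * 2 ^ 0) + of_int t" for t
    by (simp add: field_simps)
  then have *: "circ (of_int m / (3 * 2 ^ 0)) = circ (of_int (m - 3 * t) / (3 * 2 ^ 0))" for t
    by (metis circ_add_int)
  ultimately have "\<exists>k. circ (of_int m / (3 * 2 ^ 0)) \<in> basilica_arc k 0"
  proof (elim disjE)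
    assume "m mod 6 = 1"
    then have "m = 6 * (m div 6) + 1" by presburger
    then show ?thesis unfolding basilica_arc_def by (metis insertCI)
  next
    assume "m mod 6 = 5"
    then have "m = 6 * (m div 6 + 1) - 1" by presburger
    then show ?thesis unfolding basilica_arc_def by (metis insertCI)
  next
    assume "m mod 6 = 2"
    then have "m - 3 * 1 = 6 * (m div 6) - 1" by presburger
    then show ?thesis unfolding basilica_arc_def by (metis insertCI *)
  next
    assume "m mod 6 = 4"
    then have "m - 3 * 1 = 6 * (m div 6) + 1" by presburger
    then show ?thesis unfolding basilica_arc_def by (metis insertCI *)
  qed
  then show ?case using arc_in_arcs_upto_iff[of _ 0 0] by blast
next
  case (Suc N)
  show ?case
  proof (cases "even m")
    case True
    then obtain l where m: "m = 2 * l" by blast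
    then have "\<not> 3 dvd l" using Suc.prems by auto
    then have "circ (of_int l / (3 * 2 ^ N)) \<in> \<Union>(arcs_upto N)" by (rule Suc.IH)
    then show ?thesis using arcs_upto_mono[of N "Suc N"] m by auto
  next
    case False
    then have "m = 6 * (m div 6) + 1 \<or> m = 6 * (m div 6 + 1) - 1"
      using Suc.prems by presburger
    then have "\<exists>k. circ (of_int m / (3 * 2 ^ Suc N)) \<in> basilica_arc k (Suc N)"
      unfolding basilica_arc_def by (metis insertCI)
    then show ?thesis using arc_in_arcs_upto_iff[of _ "Suc N" "Suc N"] by blast
  qed
qed

lemma circ_mem_arcs_upto_iff:
  "circ x \<in> \<Union>(arcs_upto N) \<longleftrightarrow> (\<exists>m::int. \<not> 3 dvd m \<and> x = of_int m / (3 * 2 ^ N))"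
proof
  assume "circ x \<in> \<Union>(arcs_upto N)"
  then obtain k j where kj: "circ x \<in> basilica_arc k j" "j \<le> N" unfolding arcs_upto_def by auto
  obtain e where e: "e = 1 \<or> e = -1" "circ x = circ (of_int (6 * k + e) / (3 * 2 ^ j))"
    using kj(1) by (rule basilica_arc_memE)
  obtain t where t: "x = of_int (6 * k + e) / (3 * 2 ^ j) + of_int t"
    using e(2) by (rule circ_eqE)
  define m where "m = (6 * k + e) * 2 ^ (N - j) + 3 * 2 ^ N * t"
  have p: "(2::real) ^ N = 2 ^ (N - j) * 2 ^ j" using kj(2) by (simp flip: power_add)
  have "x = of_int m / (3 * 2 ^ N)"
    unfolding t m_def by (simp add: p field_simps)
  moreover have "\<not> 3 dvd m"
  proof
    assume "3 dvd m"
    then have "3 dvd (6 * k + e) * 2 ^ (N - j)"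
      unfolding m_def by (metis dvd_add_left_iff dvd_triv_left mult.assoc)
    then have "3 dvd 6 * k + e" by simp
    with e(1) show False by presburger
  qed
  ultimately show "\<exists>m::int. \<not> 3 dvd m \<and> x = of_int m / (3 * 2 ^ N)" by blast
qed (use grid_mem_arcs_upto in auto)

lemma finite_arcs_upto: "finite (arcs_upto N)"
proof -
  have "p \<in> (\<lambda>m::int. circ (of_int m / (3 * 2 ^ N))) ` {0..<3 * 2 ^ N}" if "p \<in> \<Union>(arcs_upto N)" for p
  proof -
    obtain x where "p = circ x" by (rule circ_cases)
    with that obtain m :: int where m: "p = circ (of_int m / (3 * 2 ^ N))"
      using circ_mem_arcs_upto_iff by metis
    define M :: int where "M = 3 * 2 ^ N"
    have M: "M > 0" by (simp add: M_def)
    have "real_of_int m = of_int (m mod M + M * (m div M))" by simp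
    also have "\<dots> / of_int M = of_int (m mod M) / of_int M + of_int (m div M)"
      unfolding of_int_add of_int_mult using M by (simp add: add_divide_distrib)
    finally have "p = circ (of_int (m mod M) / of_int M)"
      using m by (simp add: M_def)
    then show ?thesis using M by (simp add: M_def) 
  qed
  then have "finite (\<Union>(arcs_upto N))"
    by (meson finite_atLeastLessThan_int finite_imageI finite_subset subsetI)
  then show ?thesis by (rule finite_UnionD)
qed

section \<open>Vertices and intervals of a diagram\<close>

lemma strict_mono_intI:
  fixes v :: "int \<Rightarrow> real"
  assumes "\<And>i. v i < v (i + 1)"
  shows "strict_mono v"
proof (rule strict_monoI)
  fix i j :: int
  assume "i < j"
  then show "v i < v j"
  proof (induction j rule: int_gr_induct)
    case base
    show ?case by (rule assms)
  next
    case (step j)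
    then show ?case using assms[of j] by simp
  qed
qed

text \<open>The real representatives of a finite set of points of the circle form a bi-infinite
  increasing sequence. This makes "consecutive vertices" precise, and an isomorphism of diagrams
  becomes a shift of the index.\<close>
lemma vertex_enumeration:
  fixes V :: "circle set"
  assumes "finite V" "V \<noteq> {}"
  obtains v :: "int \<Rightarrow> real"
  where "strict_mono v" "range v = {x. circ x \<in> V}" "\<And>i. v (i + int (card V)) = v i + 1"
proof -
  define S where "S = {x \<in> {0..<1}. circ x \<in> V}"
  have inj: "inj_on circ S"
  proof (rule inj_onI)
    fix x y assume xy: "x \<in> S" "y \<in> S" "circ x = circ y"
    then obtain k :: int where k: "x = y + of_int k" by (blast elim: circ_eqE)
    with xy(1,2) have "\<bar>real_of_int k\<bar> < 1" by (auto simp: S_def)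
    then have "k = 0" by simp
    with k show "x = y" by simp
  qed
  have frac: "frac x \<in> S" if "circ x \<in> V" for x
  proof -
    have "circ (frac x) = circ (frac x + of_int \<lfloor>x\<rfloor>)" by simp
    also have "\<dots> = circ x" by (simp add: frac_def)
    finally show ?thesis using that by (simp add: S_def frac_lt_1)
  qed
  have im: "circ ` S = V"
  proof
    show "V \<subseteq> circ ` S"
    proof
      fix p assume p: "p \<in> V"
      obtain x where x: "p = circ x" by (rule circ_cases)
      have "circ (frac x) = circ (frac x + of_int \<lfloor>x\<rfloor>)" by simp
      also have "\<dots> = p" by (simp add: frac_def x)
      finally show "p \<in> circ ` S" using frac p x by (metis imageI)
    qed
  qed (auto simp: S_def)
  have fin: "finite S" using assms(1) im inj finite_imageD by metis
  define L where "L = sorted_list_of_set S"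
  define n where "n = int (card V)"
  have len: "int (length L) = n" unfolding L_def n_def im[symmetric] using inj by (simp add: card_image)
  have setL: "set L = S" unfolding L_def using fin by simp
  have sL: "sorted_wrt (<) L" unfolding L_def by simp
  have n0: "n > 0" unfolding n_def using assms by (simp add: card_gt_0_iff)
  define v where "v i = L ! nat (i mod n) + of_int (i div n)" for i
  have nth: "L ! nat (i mod n) \<in> S" for i
  proof -
    have "nat (i mod n) < length L" using n0 len by (simp add: nat_less_iff)
    then show ?thesis using setL nth_mem by blast
  qed
  have step: "v i < v (i + 1)" for i
  proof (cases "i mod n = n - 1")
    case True
    then have "(i + 1) mod n = 0" using n0
      by (metis diff_add_cancel mod_add_left_eq mod_self)
    moreover have "(i + 1) div n = i div n + 1"
      using True n0 \<open>(i + 1) mod n = 0\<close>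
      by (smt (verit) div_mult_mod_eq mult_cancel_right1 left_diff_distrib mult_right_cancel)
    ultimately have "v (i + 1) = L ! nat (0 mod n) + of_int (i div n) + 1"
      unfolding v_def by simp
    then show ?thesis using nth[of i] nth[of 0] unfolding v_def by (auto simp: S_def)
  next
    case False
    have b: "0 \<le> i mod n" "i mod n < n" using n0 by simp_all
    with False have lt: "i mod n + 1 < n" by linarith
    have i: "i + 1 = (i mod n + 1) + n * (i div n)" by simp
    have m: "(i + 1) mod n = i mod n + 1"
      using b lt by (subst i) (simp only: mod_mult_self2 mod_pos_pos_trivial)
    have d: "(i + 1) div n = i div n"
      using b lt n0 by (subst i, subst div_mult_self2) (simp_all only: div_pos_pos_trivial)
    have "L ! nat (i mod n) < L ! nat (i mod n + 1)"
      by (rule sorted_wrt_nth_less[OF sL]) (use b lt len in linarith)+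
    then show ?thesis unfolding v_def m d by simp
  qed
  show ?thesis
  proof (rule that[of v])
    show "strict_mono v" by (rule strict_mono_intI) (rule step)
    show "v (i + int (card V)) = v i + 1" for i
      unfolding v_def n_def[symmetric] using n0 by simp
    show "range v = {x. circ x \<in> V}"
    proof
      show "range v \<subseteq> {x. circ x \<in> V}"
        unfolding v_def using nth by (auto simp: S_def)
      show "{x. circ x \<in> V} \<subseteq> range v"
      proof
        fix x assume "x \<in> {x. circ x \<in> V}"
        then have "frac x \<in> set L" using frac setL by simp
        then obtain j where j: "j < length L" "L ! j = frac x" by (metis in_set_conv_nth)
        have "v (int j + n * \<lfloor>x\<rfloor>) = x"
          unfolding v_def using j len n0 by (simp add: frac_def div_pos_pos_trivial mod_pos_pos_trivial)
        then show "x \<in> range v" by (metis rangeI)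
      qed
    qed
  qed
qed

lemma shift_multiple:
  fixes v :: "int \<Rightarrow> real"
  assumes "\<And>i. v (i + n) = v i + 1"
  shows "v (i + n * k) = v i + of_int k"
proof (induction k rule: int_induct[where k = 0])
  case base
  show ?case by simp
next
  case (step1 k)
  then show ?case using assms[of "i + n * k"] by (simp add: distrib_left add.assoc)
next
  case (step2 k)
  then show ?case using assms[of "i + n * (k - 1)"] by (simp add: right_diff_distrib)
qed

lemma strict_mono_int_locate:
  fixes v :: "int \<Rightarrow> real"
  assumes v: "strict_mono v" and per: "\<And>i. v (i + int n) = v i + 1"
  obtains i where "v i \<le> x" "x < v (i + 1)"
proof -
  have multi: "v (int n * k) = v 0 + of_int k" for k :: int
    using shift_multiple[of v "int n", OF per, of 0 k] by simp
  have "\<exists>i. v i \<le> x \<and> x < v (i + 1)" if "v a \<le> x" "x < v (a + int k)" for a k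
    using that
  proof (induction k)
    case (Suc k)
    show ?case
    proof (cases "x < v (a + int k)")
      case True
      then show ?thesis using Suc by blast
    next
      case False
      moreover have "a + int (Suc k) = (a + int k) + 1" by simp
      ultimately show ?thesis using Suc.prems(2) by (metis not_le)
    qed
  qed simp
  moreover have "v (int n * \<lfloor>x - v 0\<rfloor>) \<le> x" unfolding multi by linarith
  moreover have "x < v (int n * \<lfloor>x - v 0\<rfloor> + int n)" unfolding per multi by linarith
  ultimately show ?thesis using that by blast
qed

lemma circle_interval_enum:
  assumes v: "strict_mono v" "range v = {x. circ x \<in> \<Union>D}"
  shows "circle_interval D a b \<longleftrightarrow> (\<exists>i::int. a = v i \<and> b = v (i + 1))"
proof -
  have less: "v i < v j \<longleftrightarrow> i < j" for i j by (rule strict_mono_less[OF v(1)])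
  have mem: "circ x \<in> \<Union>D \<longleftrightarrow> x \<in> range v" for x using v(2) by simp
  have ci: "circle_interval D a b \<longleftrightarrow>
    a < b \<and> a \<in> range v \<and> b \<in> range v \<and> (\<forall>x. a < x \<and> x < b \<longrightarrow> x \<notin> range v)"
    unfolding circle_interval_def mem ..
  show ?thesis
  proof
    assume ab: "circle_interval D a b"
    then obtain i j where ij: "a = v i" "b = v j" unfolding ci by fast
    have "a < b" using ab unfolding ci by simp
    then have "i < j" unfolding ij less .
    moreover have "\<not> i + 1 < j"
    proof
      assume "i + 1 < j"
      then have "a < v (i + 1)" "v (i + 1) < b" unfolding ij less by simp_all
      moreover have "\<forall>x. a < x \<and> x < b \<longrightarrow> x \<notin> range v" using ab unfolding ci by simp
      ultimately show False by (meson rangeI)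
    qed
    ultimately have "j = i + 1" by linarith
    with ij have "a = v i \<and> b = v (i + 1)" by simp
    then show "\<exists>i. a = v i \<and> b = v (i + 1)" by (rule exI)
  next
    assume "\<exists>i. a = v i \<and> b = v (i + 1)"
    then obtain i where i: "a = v i" "b = v (i + 1)" by (elim exE conjE)
    have "x \<notin> range v" if x: "a < x" "x < b" for x
    proof
      assume "x \<in> range v"
      then obtain k where "x = v k" by (rule rangeE)
      with x have "i < k" "k < i + 1" unfolding i by (simp_all only: less)
      then show False by linarith
    qed
    moreover have "a < b" unfolding i less by simp
    ultimately show "circle_interval D a b" unfolding ci using i by simp
  qed
qed

lemma circle_interval_translate:
  "circle_interval D a b \<Longrightarrow> circle_interval D (a + of_int k) (b + of_int k)"
  unfolding circle_interval_def
proof (elim conjE, intro conjI allI impI)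
  fix x assume *: "\<forall>x. a < x \<and> x < b \<longrightarrow> circ x \<notin> \<Union> D" "a + of_int k < x \<and> x < b + of_int k"
  have "circ (x - of_int k) \<notin> \<Union>D" using * by (metis add_less_cancel_right diff_add_cancel)
  moreover have "circ x = circ (x - of_int k)" by (metis circ_add_int diff_add_cancel)
  ultimately show "circ x \<notin> \<Union>D" by simp
qed simp_all

text \<open>Two intervals of a diagram with a common interior point coincide, because an endpoint of one
  cannot lie inside the other.\<close>
lemma circle_intervals_overlap:
  assumes "circle_interval D a b" "circle_interval D c d" "max a c < min b d"
  shows "a = c" "b = d"
proof -
  have ab: "circ a \<in> \<Union>D" "circ b \<in> \<Union>D" "\<And>x. a < x \<Longrightarrow> x < b \<Longrightarrow> circ x \<notin> \<Union>D"
    and cd: "circ c \<in> \<Union>D" "circ d \<in> \<Union>D" "\<And>x. c < x \<Longrightarrow> x < d \<Longrightarrow> circ x \<notin> \<Union>D"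
    using assms(1,2) unfolding circle_interval_def by blast+
  show "a = c" using ab(1) cd(1) ab(3)[of c] cd(3)[of a] assms(3) by force
  show "b = d" using ab(2) cd(2) ab(3)[of d] cd(3)[of b] assms(3) by force
qed

section \<open>Standard intervals\<close>

text \<open>The dyadic centre \<open>c / 2\<^sup>m\<close> and the half-length \<open>1 / (3 \<cdot> 2\<^sup>m)\<close> are tied to each other. The
  bound \<open>m \<ge> 1\<close> excludes the intervals of length \<open>2/3\<close>, which no arc diagram has.\<close>
definition standard_interval :: "real \<Rightarrow> real \<Rightarrow> bool" where
  "standard_interval a b \<longleftrightarrow>
     (\<exists>(c::int) m. 1 \<le> m \<and> a = of_int (3 * c - 1) / (3 * 2 ^ m) \<and> b = of_int (3 * c + 1) / (3 * 2 ^ m))"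

lemma standard_intervalI:
  "1 \<le> m \<Longrightarrow> a = of_int (3 * c - 1) / (3 * 2 ^ m) \<Longrightarrow> b = of_int (3 * c + 1) / (3 * 2 ^ m)
    \<Longrightarrow> standard_interval a b"
  unfolding standard_interval_def by blast

lemma standard_interval_translate:
  assumes "standard_interval a b"
  shows "standard_interval (a + of_int k) (b + of_int k)"
proof -
  obtain c m where cm: "1 \<le> m" "a = of_int (3 * c - 1) / (3 * 2 ^ m)" "b = of_int (3 * c + 1) / (3 * 2 ^ m)"
    using assms unfolding standard_interval_def by blast
  show ?thesis
    by (rule standard_intervalI[of m _ "c + 2 ^ m * k"]) (use cm in \<open>simp_all add: field_simps\<close>)
qed

lemma standard_interval_length:
  assumes "standard_interval a b"
  shows "a < b" "b - a \<le> 1/3"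
proof -
  obtain c m where cm: "1 \<le> m" "a = of_int (3 * c - 1) / (3 * 2 ^ m)" "b = of_int (3 * c + 1) / (3 * 2 ^ m)"
    using assms unfolding standard_interval_def by blast
  have "b - a = 2 / (3 * 2 ^ m)" unfolding cm by (simp add: field_simps)
  moreover have "2 / (3 * 2 ^ m) \<le> 2 / (3 * (2::real) ^ 1)"
    by (rule divide_left_mono) (use cm(1) power_increasing[of 1 m "2::real"] in auto)
  moreover have "2 / (3 * 2 ^ m) > (0::real)" by simp
  moreover have "2 / (3 * (2::real) ^ 1) = 1/3" by simp
  ultimately show "a < b" "b - a \<le> 1/3" by linarith+
qed

lemma primary_arc_standard:
  assumes "a = of_int (3 * c - 1) / (3 * 2 ^ m)" "b = of_int (3 * c + 1) / (3 * 2 ^ m)"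
  shows "a + (b - a) / 4 = of_int (6 * c - 1) / (3 * 2 ^ Suc m)"
    "b - (b - a) / 4 = of_int (6 * c + 1) / (3 * 2 ^ Suc m)"
    "primary_arc a b = basilica_arc c (Suc m)"
proof -
  show 1: "a + (b - a) / 4 = of_int (6 * c - 1) / (3 * 2 ^ Suc m)"
    using assms by (simp add: field_simps)
  show 2: "b - (b - a) / 4 = of_int (6 * c + 1) / (3 * 2 ^ Suc m)"
    using assms by (simp add: field_simps)
  show "primary_arc a b = basilica_arc c (Suc m)"
    unfolding primary_arc_def basilica_arc_def 1 2 ..
qed

text \<open>Adding the primary arc keeps the intervals standard: the outer pieces have scale \<open>m + 2\<close>
  and centres \<open>(4 c - 1) / 2\<^bsup>m + 2\<^esup>\<close> and \<open>(4 c + 1) / 2\<^bsup>m + 2\<^esup>\<close>, the middle piece has scale \<open>m + 1\<close> and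
  centre \<open>c / 2\<^sup>m\<close>.\<close>
lemma standard_interval_split:
  assumes "standard_interval a b"
  shows "standard_interval a (a + (b - a) / 4)"
    "standard_interval (a + (b - a) / 4) (b - (b - a) / 4)"
    "standard_interval (b - (b - a) / 4) b"
proof -
  obtain c m where cm: "1 \<le> m" "a = of_int (3 * c - 1) / (3 * 2 ^ m)" "b = of_int (3 * c + 1) / (3 * 2 ^ m)"
    using assms unfolding standard_interval_def by blast
  show "standard_interval a (a + (b - a) / 4)"
    by (rule standard_intervalI[of "m + 2" _ "4 * c - 1"]) (use cm in \<open>simp_all add: field_simps\<close>)
  show "standard_interval (a + (b - a) / 4) (b - (b - a) / 4)"
    by (rule standard_intervalI[of "m + 1" _ "2 * c"]) (use cm in \<open>simp_all add: field_simps\<close>)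
  show "standard_interval (b - (b - a) / 4) b"
    by (rule standard_intervalI[of "m + 2" _ "4 * c + 1"]) (use cm in \<open>simp_all add: field_simps\<close>)
qed

text \<open>The vertices are the multiples of \<open>1 / (3 \<cdot> 2\<^sup>N)\<close> whose numerator is not divisible by \<open>3\<close>, so
  an interval either jumps over a multiple of \<open>3\<close> and is standard of scale \<open>N\<close>, or joins two
  neighbouring multiples and is standard of scale \<open>N + 1\<close>.\<close>
lemma circle_interval_arcs_upto_standard:
  assumes ab: "circle_interval (arcs_upto N) a b" and N: "1 \<le> N"
  shows "standard_interval a b"
proof -
  obtain m where m: "\<not> 3 dvd m" "a = of_int m / (3 * 2 ^ N)"
    using ab circ_mem_arcs_upto_iff unfolding circle_interval_def by blast
  obtain l where l: "\<not> 3 dvd l" "b = of_int l / (3 * 2 ^ N)"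
    using ab circ_mem_arcs_upto_iff unfolding circle_interval_def by blast
  have ml: "m < l" using ab unfolding circle_interval_def m(2) l(2) by (simp add: divide_less_cancel)
  have between: "\<not> (m < j \<and> j < l)" if "\<not> 3 dvd j" for j
  proof
    assume "m < j \<and> j < l"
    then have "a < of_int j / (3 * 2 ^ N)" "of_int j / (3 * 2 ^ N) < b"
      unfolding m(2) l(2) by (simp_all add: divide_strict_right_mono)
    moreover have "circ (of_int j / (3 * 2 ^ N)) \<in> \<Union>(arcs_upto N)"
      using that by (rule grid_mem_arcs_upto)
    ultimately show False using ab unfolding circle_interval_def by blast
  qed
  have "m mod 3 = 2 \<or> m mod 3 = 1" using m(1) by presburger
  then consider c where "m = 3 * c - 1" | c where "m = 3 * c + 1"
  proof (elim disjE)
    assume "m mod 3 = 2"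
    then have "m = 3 * (m div 3 + 1) - 1" by presburger
    then show thesis by (rule that(1))
  next
    assume "m mod 3 = 1"
    then have "m = 3 * (m div 3) + 1" by presburger
    then show thesis by (rule that(2))
  qed
  then show ?thesis
  proof cases
    case (1 c)
    have "\<not> 3 dvd 3 * c + 1" by presburger
    then have "l \<le> 3 * c + 1" using between[of "3 * c + 1"] 1 by linarith
    moreover have "l \<noteq> 3 * c" using l(1) by auto
    ultimately have "l = 3 * c + 1" using ml 1 by linarith
    then show ?thesis using 1 N m l by (intro standard_intervalI[of N _ c]) auto
  next
    case (2 c)
    have "\<not> 3 dvd 3 * c + 2" by presburger
    then have "l \<le> 3 * c + 2" using between[of "3 * c + 2"] 2 by linarith
    then have "l = 3 * c + 2" using ml 2 by linarith
    then show ?thesis using 2 N m l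
      by (intro standard_intervalI[of "N + 1" _ "2 * c + 1"]) (auto simp: field_simps)
  qed
qed

section \<open>Arc diagrams are the diagrams with standard intervals\<close>

lemma circ_inj_near:
  assumes "circ x = circ y" "\<bar>x - y\<bar> < 1"
  shows "x = y"
proof -
  obtain k :: int where k: "x = y + of_int k" using assms(1) by (rule circ_eqE)
  with assms(2) have "\<bar>real_of_int k\<bar> < 1" by simp
  then have "k = 0" by simp
  with k show ?thesis by simp
qed

text \<open>The diagram from which all others are built is the uniform diagram of level \<open>1\<close>.\<close>
lemma arcs_upto_1: "arcs_upto 1 = {{circ (1/3), circ (2/3)}, {circ (1/6), circ (5/6)}}"
proof -
  have 1: "basilica_arc k 1 = {circ (1/6), circ (5/6)}" for k
  proof -
    have "circ (of_int (6 * k - 1) / 6) = circ (5/6 + of_int (k - 1))"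
      by (rule arg_cong[of _ _ circ]) (simp add: field_simps)
    moreover have "circ (of_int (6 * k + 1) / 6) = circ (1/6 + of_int k)"
      by (rule arg_cong[of _ _ circ]) (simp add: field_simps)
    ultimately show ?thesis
      unfolding basilica_arc_def circ_add_int by (simp add: insert_commute)
  qed
  have "arcs_upto 1 = {basilica_arc k m | k m. m = 0 \<or> m = 1}"
    unfolding arcs_upto_def by (simp add: le_Suc_eq disj_commute)
  also have "\<dots> = {basilica_arc k 0 | k. True} \<union> {basilica_arc k 1 | k. True}" by blast
  also have "\<dots> = {{circ (1/3), circ (2/3)}, {circ (1/6), circ (5/6)}}"
    unfolding basilica_arc_0 1 by auto
  finally show ?thesis .
qed

text \<open>An interval of the larger diagram that ends in one of the two new vertices overlaps a
  translate of one of the three pieces of \<open>[a, b]\<close> and therefore equals it. All other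
  intervals are intervals of \<open>D\<close>.\<close>
lemma insert_primary_arc_standard:
  assumes std: "\<And>x y. circle_interval D x y \<Longrightarrow> standard_interval x y"
    and ab: "circle_interval D a b"
    and xy: "circle_interval (insert (primary_arc a b) D) x y"
  shows "standard_interval x y"
proof -
  define p q where "p = a + (b - a) / 4" and "q = b - (b - a) / 4"
  let ?D' = "insert (primary_arc a b) D"
  have len: "a < b" "b - a \<le> 1/3" using standard_interval_length[OF std[OF ab]] by simp_all
  then have ord: "a < p" "p < q" "q < b" unfolding p_def q_def by (simp_all add: field_simps)
  have D': "\<Union>?D' = insert (circ p) (insert (circ q) (\<Union>D))"
    by (simp add: primary_arc_def p_def q_def)
  have split: "circle_interval ?D' u w"
    if "u \<in> {a, p, q, b}" "w \<in> {a, p, q, b}" "u < w" "\<And>z. z \<in> {p, q} \<Longrightarrow> \<not> (u < z \<and> z < w)" for u w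
    unfolding circle_interval_def
  proof (intro conjI allI impI)
    show "u < w" by fact
    show "circ u \<in> \<Union>?D'" "circ w \<in> \<Union>?D'"
      using that(1,2) ab unfolding D' circle_interval_def by auto
    fix x assume x: "u < x \<and> x < w"
    then have ax: "a < x" "x < b" using that(1,2) ord by auto
    then have "circ x \<notin> \<Union>D" using ab unfolding circle_interval_def by blast
    moreover have "circ x \<noteq> circ z" if z: "z \<in> {p, q}" for z
    proof
      assume "circ x = circ z"
      moreover have "\<bar>x - z\<bar> < 1" using ax ord len z by auto
      ultimately have "x = z" by (rule circ_inj_near)
      then show False using x z \<open>\<And>z. z \<in> {p, q} \<Longrightarrow> \<not> (u < z \<and> z < w)\<close> by blast
    qed
    ultimately show "circ x \<notin> \<Union>?D'" unfolding D' by simp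
  qed
  have new: "circle_interval ?D' a p \<and> standard_interval a p"
    "circle_interval ?D' p q \<and> standard_interval p q"
    "circle_interval ?D' q b \<and> standard_interval q b"
  proof -
    have "circle_interval ?D' a p" by (rule split) (use ord in auto)
    moreover have "circle_interval ?D' p q" by (rule split) (use ord in auto)
    moreover have "circle_interval ?D' q b" by (rule split) (use ord in auto)
    moreover note standard_interval_split[OF std[OF ab], folded p_def q_def]
    ultimately show "circle_interval ?D' a p \<and> standard_interval a p"
      "circle_interval ?D' p q \<and> standard_interval p q"
      "circle_interval ?D' q b \<and> standard_interval q b" by simp_all
  qed
  have overlap: "standard_interval x y"
    if uw: "circle_interval ?D' u w \<and> standard_interval u w"
      and mm: "max x (u + of_int k) < min y (w + of_int k)" for u w and k :: int
  proof -
    have "x = u + of_int k" "y = w + of_int k"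
      using circle_intervals_overlap[OF xy circle_interval_translate mm] uw by blast+
    then show ?thesis using standard_interval_translate uw by blast
  qed
  have xy0: "x < y" using xy unfolding circle_interval_def by blast
  have mem: "circ x \<in> insert (circ p) (insert (circ q) (\<Union>D))"
    "circ y \<in> insert (circ p) (insert (circ q) (\<Union>D))"
    using xy unfolding circle_interval_def D' by blast+
  show ?thesis
  proof (cases "circ x \<in> \<Union>D \<and> circ y \<in> \<Union>D")
    case True
    then have "circle_interval D x y" using xy unfolding circle_interval_def D' by blast
    then show ?thesis by (rule std)
  next
    case False
    with mem consider "circ x = circ p" | "circ x = circ q" | "circ y = circ p" | "circ y = circ q"
      by blast
    then show ?thesis
    proof cases
      case 1
      then obtain k where "x = p + of_int k" by (rule circ_eqE)
      then show ?thesis using overlap[OF new(2), of k] xy0 ord by simp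
    next
      case 2
      then obtain k where "x = q + of_int k" by (rule circ_eqE)
      then show ?thesis using overlap[OF new(3), of k] xy0 ord by simp
    next
      case 3
      then obtain k where "y = p + of_int k" by (rule circ_eqE)
      then show ?thesis using overlap[OF new(1), of k] xy0 ord by simp
    next
      case 4
      then obtain k where "y = q + of_int k" by (rule circ_eqE)
      then show ?thesis using overlap[OF new(2), of k] xy0 ord by simp
    qed
  qed
qed

lemma arc_diagram_imp_standard:
  assumes "arc_diagram D"
  shows "finite D \<and> arcs_upto 1 \<subseteq> D \<and> D \<subseteq> basilica_lamination \<and>
    (\<forall>a b. circle_interval D a b \<longrightarrow> standard_interval a b)"
  using assms
proof induction
  case base
  then show ?case
    using finite_arcs_upto[of 1] arcs_upto_subset[of 1] circle_interval_arcs_upto_standard[of 1]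
    unfolding arcs_upto_1 by blast
next
  case (step D a b)
  have "standard_interval a b" using step by blast
  then obtain c m where "primary_arc a b = basilica_arc c (Suc m)"
    unfolding standard_interval_def using primary_arc_standard(3) by blast
  then have "primary_arc a b \<in> basilica_lamination" unfolding basilica_lamination_eq by blast
  then show ?case using step insert_primary_arc_standard[of D a b] by blast
qed

lemma lamination_subset_enumeration:
  assumes "finite D" "arcs_upto 1 \<subseteq> D" "D \<subseteq> basilica_lamination"
  obtains v :: "int \<Rightarrow> real"
  where "strict_mono v" "range v = {x. circ x \<in> \<Union>D}" "0 < card (\<Union>D)"
    "\<And>i. v (i + int (card (\<Union>D))) = v i + 1"
proof -
  have "finite A" if "A \<in> D" for A
    using that assms(3) unfolding basilica_lamination_eq basilica_arc_def by blast
  then have fin: "finite (\<Union>D)" using assms(1) by blast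
  have ne: "\<Union>D \<noteq> {}" using assms(2) unfolding arcs_upto_1 by blast
  have card: "0 < card (\<Union>D)" using fin ne by (simp add: card_gt_0_iff)
  show ?thesis
    by (rule vertex_enumeration[OF fin ne]) (rule that[OF _ _ card])
qed

text \<open>Arithmetic core of the removal of an arc: a standard interval that starts at an endpoint
  \<open>(6 k + e) / (3 \<cdot> 2\<^sup>N)\<close> of an arc of level \<open>N\<close>, away from that arc, and ends in a point
  \<open>j / (3 \<cdot> 2\<^sup>N)\<close>, must have scale \<open>N + 1\<close>. A coarser scale contradicts the residues modulo \<open>2\<close> and
  \<open>3\<close>, and a finer one leaves no room for the other end. The sign \<open>e\<close> covers both sides.\<close>
lemma neighbour_of_finest_arc:
  fixes c e j k :: int
  assumes e: "e = 1 \<or> e = -1"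
    and 1: "(6 * k + e) * 2 ^ m = (3 * c - e) * 2 ^ N"
    and 2: "(3 * c + e) * 2 ^ N = j * 2 ^ m"
  shows "j = 6 * k + 2 * e"
proof -
  define d where "d = e * (j - 6 * k - e)"
  have ee: "e * e = 1" using e by auto
  have "(j - 6 * k - e) * 2 ^ m = e * 2 ^ Suc N" using 1 2 by (simp add: algebra_simps)
  then have "d * 2 ^ m = (e * e) * 2 ^ Suc N" unfolding d_def by (simp add: mult.assoc)
  then have d: "d * 2 ^ m = 2 ^ Suc N" using ee by simp
  then have d0: "1 \<le> d" by (smt (verit) zero_less_mult_pos2 zero_less_power)
  have "m \<le> Suc N"
  proof (rule ccontr)
    assume "\<not> m \<le> Suc N"
    then have "(2::int) ^ Suc N < 2 ^ m" by (intro power_strict_increasing) simp_all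
    also have "\<dots> \<le> d * 2 ^ m" using d0 by simp
    finally show False using d by simp
  qed
  moreover have "\<not> m \<le> N"
  proof
    assume mN: "m \<le> N"
    then have p: "(2::int) ^ N = 2 ^ (N - m) * 2 ^ m" by (simp flip: power_add)
    have "(6 * k + e) * 2 ^ m = ((3 * c - e) * 2 ^ (N - m)) * 2 ^ m" using 1 unfolding p by simp
    then have eq: "6 * k + e = (3 * c - e) * 2 ^ (N - m)" by simp
    show False
    proof (cases "N = m")
      case True
      then have "6 * k + e = 3 * c - e" using eq by simp
      then show False using e by presburger
    next
      case False
      then have "even ((3 * c - e) * 2 ^ (N - m))" using mN by simp
      then show False unfolding eq[symmetric] using e by auto
    qed
  qed
  ultimately have "m = Suc N" by simp
  then have "d = 1" using d by simp
  then have "e * d = e" by simp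
  then have "j - 6 * k - e = e" unfolding d_def using ee by (metis mult.assoc mult_1)
  then show ?thesis by simp
qed

text \<open>An arc of the highest level \<open>N\<close> has no vertices between its two endpoints, and the intervals on
  both sides have half its length. So the arc is the primary arc of the interval obtained by
  merging the three, and the merged interval is again standard.\<close>
lemma innermost_arc_removal:
  assumes fin: "finite D" and base: "arcs_upto 1 \<subseteq> D" and lam: "D \<subseteq> basilica_lamination"
    and std: "\<And>a b. circle_interval D a b \<Longrightarrow> standard_interval a b"
    and ne: "D \<noteq> arcs_upto 1"
  obtains A a b where "A \<in> D" "A \<notin> arcs_upto 1" "A = primary_arc a b"
    "circle_interval (D - {A}) a b"
    "\<And>x y. circle_interval (D - {A}) x y \<Longrightarrow> standard_interval x y"
proof -
  obtain N0 where N0: "D \<subseteq> arcs_upto N0"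
    by (rule finite_lamination_subset_arcs_upto[OF fin lam])
  define N where "N = (LEAST N. D \<subseteq> arcs_upto N)"
  have N: "D \<subseteq> arcs_upto N" unfolding N_def using N0 by (rule LeastI)
  have min: "\<not> D \<subseteq> arcs_upto M" if "M < N" for M
    using that unfolding N_def by (rule not_less_Least)
  \<comment> \<open>Otherwise \<open>D\<close> would be the initial diagram.\<close>
  have N2: "2 \<le> N"
  proof (rule ccontr)
    assume "\<not> 2 \<le> N"
    then have "arcs_upto N \<subseteq> arcs_upto 1" by (intro arcs_upto_mono) simp
    then show False using N base ne by blast
  qed
  have "\<not> D \<subseteq> arcs_upto (N - 1)" using min[of "N - 1"] N2 by simp
  then obtain A where A: "A \<in> D" "A \<notin> arcs_upto (N - 1)" by blast
  obtain k m where km: "A = basilica_arc k m" "m \<le> N" using A(1) N unfolding arcs_upto_def by blast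
  have "m = N" using A(2) km N2 unfolding km(1) arc_in_arcs_upto_iff by linarith
  with km have k: "A = basilica_arc k N" by simp
  have A1: "A \<notin> arcs_upto 1" unfolding k arc_in_arcs_upto_iff using N2 by simp
  define P where "P j = real_of_int j / (3 * 2 ^ N)" for j
  define p q a b where "p = P (6 * k - 1)" and "q = P (6 * k + 1)"
    and "a = P (6 * k - 2)" and "b = P (6 * k + 2)"
  have Apq: "A = {circ p, circ q}" unfolding k basilica_arc_def p_def q_def P_def ..
  have P_less: "P i < P j \<longleftrightarrow> i < j" for i j
    unfolding P_def by (simp add: divide_less_cancel)
  have vertex: "\<exists>j. \<not> 3 dvd j \<and> x = P j" if "circ x \<in> \<Union>D" for x
    using that N circ_mem_arcs_upto_iff[of x N] unfolding P_def by blast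
  have ab: "primary_arc a b = A"
  proof -
    have "a + (b - a) / 4 = p" "b - (b - a) / 4 = q"
      unfolding a_def b_def p_def q_def P_def by (simp_all add: field_simps)
    then show ?thesis unfolding primary_arc_def Apq by simp
  qed
  obtain v :: "int \<Rightarrow> real" where v: "strict_mono v" "range v = {x. circ x \<in> \<Union>D}"
    by (rule lamination_subset_enumeration[OF fin base lam])
  note enum = circle_interval_enum[OF v]
  have bnd: "circle_interval D q b"
  proof -
    have "circ q \<in> \<Union>D" using A(1) Apq by blast
    then have "q \<in> range v" using v(2) by simp
    then obtain i where "q = v i" by (rule rangeE)
    then have "circle_interval D q (v (i + 1))" unfolding enum by (intro exI[of _ i]) simp
    then obtain y where y: "circle_interval D q y" by (rule exI[THEN exE])
    obtain c m' where cm: "q = of_int (3 * c - 1) / (3 * 2 ^ m')" "y = of_int (3 * c + 1) / (3 * 2 ^ m')"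
      using std[OF y] unfolding standard_interval_def by blast
    obtain j where j: "y = P j" using y vertex unfolding circle_interval_def by blast
    have "P (6 * k + 1) = of_int (3 * c - 1) / (3 * 2 ^ m')" "P j = of_int (3 * c + 1) / (3 * 2 ^ m')"
      using cm unfolding q_def j by simp_all
    then have "real_of_int ((6 * k + 1) * 2 ^ m') = of_int ((3 * c - 1) * 2 ^ N)"
      "real_of_int ((3 * c + 1) * 2 ^ N) = of_int (j * 2 ^ m')"
      unfolding P_def by (simp_all add: field_simps)
    then have "(6 * k + 1) * 2 ^ m' = (3 * c - 1) * 2 ^ N" "(3 * c + 1) * 2 ^ N = j * 2 ^ m'"
      by (simp_all only: of_int_eq_iff)
    then have "j = 6 * k + 2" using neighbour_of_finest_arc[of 1] by simp
    then have "y = b" unfolding j b_def by simp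
    with y show ?thesis by simp
  qed
  have abnd: "circle_interval D a p"
  proof -
    have "circ p \<in> \<Union>D" using A(1) Apq by blast
    then have "p \<in> range v" using v(2) by simp
    then obtain i where "p = v i" by (rule rangeE)
    then have "circle_interval D (v (i - 1)) p" unfolding enum by (intro exI[of _ "i - 1"]) simp
    then obtain x where x: "circle_interval D x p" by (rule exI[THEN exE])
    obtain c m' where cm: "x = of_int (3 * c - 1) / (3 * 2 ^ m')" "p = of_int (3 * c + 1) / (3 * 2 ^ m')"
      using std[OF x] unfolding standard_interval_def by blast
    obtain j where j: "x = P j" using x vertex unfolding circle_interval_def by blast
    have "P (6 * k - 1) = of_int (3 * c + 1) / (3 * 2 ^ m')" "P j = of_int (3 * c - 1) / (3 * 2 ^ m')"
      using cm unfolding p_def j by simp_all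
    then have "real_of_int ((6 * k - 1) * 2 ^ m') = of_int ((3 * c + 1) * 2 ^ N)"
      "real_of_int ((3 * c - 1) * 2 ^ N) = of_int (j * 2 ^ m')"
      unfolding P_def by (simp_all add: field_simps)
    then have "(6 * k - 1) * 2 ^ m' = (3 * c + 1) * 2 ^ N" "(3 * c - 1) * 2 ^ N = j * 2 ^ m'"
      by (simp_all only: of_int_eq_iff)
    then have "j = 6 * k - 2" using neighbour_of_finest_arc[of "-1"] by simp
    then have "x = a" unfolding j a_def by simp
    with x show ?thesis by simp
  qed
  have D': "\<Union>(D - {A}) = \<Union>D - {circ p, circ q}"
  proof -
    have "\<Union>(D - {A}) \<inter> A = {}"
      using lamination_disjoint A(1) lam by blast
    then show ?thesis using Apq A(1) by blast
  qed
  have parity: "circ (P (2 * i)) \<noteq> circ (P j)" if "odd j" for i j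
  proof
    assume "circ (P (2 * i)) = circ (P j)"
    then obtain t where "(2 * i) * 2 ^ (N - N) = j + 3 * 2 ^ N * t"
      unfolding P_def by (rule circ_grid_eqE) simp
    moreover have "even (3 * 2 ^ N * t)" using N2 by simp
    ultimately show False using that by (metis dvd_triv_left even_add even_mult_iff)
  qed
  have ints: "circle_interval (D - {A}) a b"
    unfolding circle_interval_def
  proof (intro conjI allI impI)
    show "a < b" unfolding a_def b_def P_less by simp
    have "circ a \<notin> {circ p, circ q}" "circ b \<notin> {circ p, circ q}"
      using parity[of _ "3 * k - 1"] parity[of _ "3 * k + 1"]
      unfolding a_def b_def p_def q_def by (auto dest: parity[rotated])
    then show "circ a \<in> \<Union>(D - {A})" "circ b \<in> \<Union>(D - {A})"
      using abnd bnd unfolding D' circle_interval_def by blast+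
    fix x assume x: "a < x \<and> x < b"
    show "circ x \<notin> \<Union>(D - {A})"
    proof
      assume "circ x \<in> \<Union>(D - {A})"
      then have xD: "circ x \<in> \<Union>D" "x \<noteq> p" "x \<noteq> q" unfolding D' by auto
      obtain j where j: "\<not> 3 dvd j" "x = P j" using vertex[OF xD(1)] by blast
      have "6 * k - 2 < j" "j < 6 * k + 2" "j \<noteq> 6 * k - 1" "j \<noteq> 6 * k + 1"
        using x xD j(2) P_less unfolding a_def b_def p_def q_def by auto
      then have "j = 6 * k" by linarith
      with j(1) show False by simp
    qed
  qed
  have std': "standard_interval x y" if xy: "circle_interval (D - {A}) x y" for x y
  proof (cases "\<exists>z. x < z \<and> z < y \<and> circ z \<in> A")
    case True
    then obtain z where z: "x < z" "z < y" "circ z = circ p \<or> circ z = circ q"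
      unfolding Apq by blast
    have apqb: "a < p" "p < b" "a < q" "q < b"
      unfolding a_def b_def p_def q_def P_less by simp_all
    have "\<exists>t::int. a + of_int t < z \<and> z < b + of_int t"
      using z(3) apqb by (metis add_less_cancel_right circ_eqE)
    then obtain t :: int where t: "a + of_int t < z" "z < b + of_int t" by blast
    have "max x (a + of_int t) < min y (b + of_int t)" using z t by simp
    then have "x = a + of_int t" "y = b + of_int t"
      using circle_intervals_overlap[OF xy circle_interval_translate[OF ints]] by blast+
    moreover have "standard_interval a b"
      unfolding a_def b_def P_def using N2
      by (intro standard_intervalI[of "N - 1" _ k])
        (auto simp: power_diff field_simps)
    ultimately show ?thesis using standard_interval_translate by blast
  next
    case False
    then have "circle_interval D x y"
      using xy unfolding circle_interval_def D' Apq by blast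
    then show ?thesis by (rule std)
  qed
  show ?thesis by (rule that[OF A(1) A1 ab[symmetric] ints std'])
qed

lemma arc_diagramI:
  assumes "finite D" "arcs_upto 1 \<subseteq> D" "D \<subseteq> basilica_lamination"
    and "\<And>a b. circle_interval D a b \<Longrightarrow> standard_interval a b"
  shows "arc_diagram D"
  using assms
proof (induction "card D" arbitrary: D rule: less_induct)
  case less
  show ?case
  proof (cases "D = arcs_upto 1")
    case True
    then show ?thesis unfolding arcs_upto_1 by (simp add: arc_diagram.base)
  next
    case False
    obtain A a b where A: "A \<in> D" "A \<notin> arcs_upto 1" "A = primary_arc a b"
      "circle_interval (D - {A}) a b"
      "\<And>x y. circle_interval (D - {A}) x y \<Longrightarrow> standard_interval x y"
      using innermost_arc_removal[OF less.prems(1-4) False] by metis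
    have "arc_diagram (D - {A})"
    proof (rule less.hyps)
      show "card (D - {A}) < card D" using A(1) less.prems(1) by (rule card_Diff1_less[rotated])
    qed (use A less.prems in auto)
    then have "arc_diagram (insert (primary_arc a b) (D - {A}))"
      using A(4) by (rule arc_diagram.step)
    moreover have "insert (primary_arc a b) (D - {A}) = D" using A(1,3) by blast
    ultimately show ?thesis by simp
  qed
qed

section \<open>Monotone lifts\<close>

text \<open>Orientation-preserving homeomorphisms of the circle, given by their lifts. Continuity is
  replaced by surjectivity, which for increasing functions is equivalent under the functional
  equation and is easier to check and to transfer to inverses.\<close>
definition monotone_lift :: "(real \<Rightarrow> real) \<Rightarrow> (circle \<Rightarrow> circle) \<Rightarrow> bool" where
  "monotone_lift F f \<longleftrightarrow>
     strict_mono F \<and> surj F \<and> (\<forall>x. F (x + 1) = F x + 1) \<and> (\<forall>x. f (circ x) = circ (F x))"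

text \<open>Affinity stated without a slope: in this form it passes to compositions and inverses by mere
  substitution.\<close>
definition affine_between :: "(real \<Rightarrow> real) \<Rightarrow> real \<Rightarrow> real \<Rightarrow> bool" where
  "affine_between F a b \<longleftrightarrow> (\<forall>t\<in>{0..1}. F (a + t * (b - a)) = F a + t * (F b - F a))"

lemma monotone_liftD:
  assumes "monotone_lift F f"
  shows "strict_mono F" "surj F" "F (x + 1) = F x + 1" "f (circ x) = circ (F x)"
  using assms unfolding monotone_lift_def by blast+

lemma monotone_lift_less: "monotone_lift F f \<Longrightarrow> F x < F y \<longleftrightarrow> x < y"
  by (rule strict_mono_less) (rule monotone_liftD)

lemma monotone_lift_eq: "monotone_lift F f \<Longrightarrow> F x = F y \<longleftrightarrow> x = y"
  by (rule strict_mono_eq) (rule monotone_liftD)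

lemma monotone_lift_add_int:
  assumes F: "monotone_lift F f"
  shows "F (x + of_int k) = F x + of_int k"
proof (induction k rule: int_induct[where k = 0])
  case base
  show ?case by simp
next
  case (step1 k)
  then show ?case using monotone_liftD(3)[OF F, of "x + of_int k"] by (simp add: add.assoc)
next
  case (step2 k)
  then show ?case using monotone_liftD(3)[OF F, of "x + of_int (k - 1)"] by simp
qed

text \<open>A monotone function with open range has no jumps.\<close>
lemma monotone_lift_continuous:
  assumes "monotone_lift F f"
  shows "continuous_on UNIV F"
proof (rule continuous_onI_mono)
  show "open (F ` UNIV)" using monotone_liftD(2)[OF assms] by simp
  show "F x \<le> F y" if "x \<le> y" for x y
    using that strict_mono_less_eq[OF monotone_liftD(1)[OF assms]] by simp
qed

lemma monotone_lift_is_lift: "monotone_lift F f \<Longrightarrow> is_lift F f"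
  unfolding is_lift_def using monotone_lift_continuous monotone_liftD(4) by blast

lemma monotone_lift_bij:
  assumes F: "monotone_lift F f"
  shows "bij f"
proof (rule bijI)
  show "inj f"
  proof (rule injI)
    fix p q assume pq: "f p = f q"
    obtain x y where xy: "p = circ x" "q = circ y" by (metis circ_cases)
    have "circ (F x) = circ (F y)" using pq monotone_liftD(4)[OF F] unfolding xy by metis
    then obtain k where "F x = F y + of_int k" by (rule circ_eqE)
    then have "F x = F (y + of_int k)" by (simp only: monotone_lift_add_int[OF F])
    then have "x = y + of_int k" by (simp only: monotone_lift_eq[OF F])
    then show "p = q" unfolding xy by simp
  qed
  show "surj f"
  proof (rule surjI)
    fix p show "f (circ (inv_into UNIV F (rep_circle p))) = p"
      using monotone_liftD(4)[OF F] surj_f_inv_f[OF monotone_liftD(2)[OF F]]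
      by (metis Quotient_abs_rep Quotient_circle)
  qed
qed

lemma monotone_lift_inv:
  assumes F: "monotone_lift F f"
  shows "monotone_lift (inv_into UNIV F) (inv_into UNIV f)" "inv_into UNIV F (F x) = x"
    "F (inv_into UNIV F x) = x"
proof -
  have s: "F (inv_into UNIV F x) = x" for x
    using monotone_liftD(2)[OF F] by (rule surj_f_inv_f)
  then show "F (inv_into UNIV F x) = x" .
  have i: "inv_into UNIV F (F x) = x" for x
    using s[of "F x"] unfolding monotone_lift_eq[OF F] .
  then show "inv_into UNIV F (F x) = x" .
  have "strict_mono (inv_into UNIV F)"
  proof (rule strict_monoI)
    fix x y :: real
    assume "x < y"
    then show "inv_into UNIV F x < inv_into UNIV F y"
      using monotone_lift_less[OF F, of "inv_into UNIV F x" "inv_into UNIV F y"] by (simp only: s)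
  qed
  moreover have "surj (inv_into UNIV F)" using i by (rule surjI)
  moreover have "inv_into UNIV F (x + 1) = inv_into UNIV F x + 1" for x
    using monotone_liftD(3)[OF F, of "inv_into UNIV F x"] i[of "inv_into UNIV F x + 1"] by (simp only: s)
  moreover have "inv_into UNIV f (circ x) = circ (inv_into UNIV F x)" for x
    using monotone_liftD(4)[OF F, of "inv_into UNIV F x"] monotone_lift_bij[OF F]
    by (metis bij_is_inj inv_f_f s)
  ultimately show "monotone_lift (inv_into UNIV F) (inv_into UNIV f)" unfolding monotone_lift_def by blast
qed

lemma monotone_lift_id: "monotone_lift id id"
  unfolding monotone_lift_def by (simp add: strict_mono_def)

lemma monotone_lift_comp:
  assumes F: "monotone_lift F f" and G: "monotone_lift G g"
  shows "monotone_lift (F \<circ> G) (f \<circ> g)"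
  unfolding monotone_lift_def
proof (intro conjI)
  show "strict_mono (F \<circ> G)"
    by (rule strict_mono_o[OF monotone_liftD(1)[OF F] monotone_liftD(1)[OF G]])
  show "surj (F \<circ> G)"
    by (rule comp_surj[OF monotone_liftD(2)[OF G] monotone_liftD(2)[OF F]])
qed (use monotone_liftD(3,4)[OF F] monotone_liftD(3,4)[OF G] in simp_all)

lemma continuous_on_circleI:
  assumes "is_lift F f"
  shows "continuous_on UNIV f"
  unfolding continuous_on_open_vimage[OF open_UNIV]
proof (intro allI impI)
  fix U :: "circle set"
  assume "open U"
  then have "open (circ -` U)" by (simp add: open_circle_def)
  moreover have "continuous_on UNIV F" using assms unfolding is_lift_def by blast
  ultimately have "open (F -` (circ -` U))" by (rule open_vimage)
  moreover have "F -` (circ -` U) = circ -` (f -` U)"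
    using assms unfolding is_lift_def by auto
  ultimately show "open (f -` U \<inter> UNIV)" by (simp add: open_circle_def)
qed

lemma monotone_lift_homeomorphism:
  assumes F: "monotone_lift F f"
  shows "homeomorphism UNIV UNIV f (inv_into UNIV f)"
proof (rule homeomorphismI)
  show "continuous_on UNIV f"
    by (rule continuous_on_circleI[OF monotone_lift_is_lift[OF F]])
  show "continuous_on UNIV (inv_into UNIV f)"
    by (rule continuous_on_circleI[OF monotone_lift_is_lift[OF monotone_lift_inv(1)[OF F]]])
  show "inv_into UNIV f (f p) = p" for p
    using monotone_lift_bij[OF F] by (simp add: bij_is_inj inv_f_f)
  show "f (inv_into UNIV f p) = p" for p
    using monotone_lift_bij[OF F] by (simp add: bij_is_surj surj_f_inv_f)
qed simp_all

section \<open>Affine pieces and interpolation\<close>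

lemma segment_bounds:
  fixes a b t :: real
  assumes "0 \<le> t" "t \<le> 1" "a \<le> b"
  shows "a \<le> a + t * (b - a)" "a + t * (b - a) \<le> b"
  using assms mult_right_mono[of t 1 "b - a"] by auto

lemma affine_between_iff_slope:
  assumes "a \<le> b"
  shows "affine_between F a b \<longleftrightarrow> (\<exists>m. \<forall>x\<in>{a..b}. F x = F a + m * (x - a))"
proof
  assume F: "affine_between F a b"
  have "F x = F a + (F b - F a) / (b - a) * (x - a)" if "x \<in> {a..b}" for x
  proof (cases "a < b")
    case True
    have "(x - a) / (b - a) \<in> {0..1}" using that True by simp
    then have "F (a + (x - a) / (b - a) * (b - a)) = F a + (x - a) / (b - a) * (F b - F a)"
      using F unfolding affine_between_def by blast
    then show ?thesis using True by simp
  next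
    case False
    then have "x = a" using that by simp
    then show ?thesis by simp
  qed
  then show "\<exists>m. \<forall>x\<in>{a..b}. F x = F a + m * (x - a)" by blast
next
  assume "\<exists>m. \<forall>x\<in>{a..b}. F x = F a + m * (x - a)"
  then obtain m where m: "\<And>x. x \<in> {a..b} \<Longrightarrow> F x = F a + m * (x - a)" by blast
  show "affine_between F a b"
    unfolding affine_between_def
  proof
    fix t :: real
    assume t: "t \<in> {0..1}"
    have "a + t * (b - a) \<in> {a..b}" using segment_bounds[of t a b] t assms by simp
    then have "F (a + t * (b - a)) = F a + m * (a + t * (b - a) - a)" by (rule m)
    then have "F (a + t * (b - a)) = F a + t * (m * (b - a))" by simp
    moreover have "F b = F a + m * (b - a)" by (rule m) (use assms in simp)
    then have "m * (b - a) = F b - F a" by simp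
    ultimately show "F (a + t * (b - a)) = F a + t * (F b - F a)" by simp
  qed
qed

lemma affine_between_subinterval:
  assumes F: "affine_between F a b" and cd: "a \<le> c" "c \<le> d" "d \<le> b"
  shows "affine_between F c d"
proof -
  have "a \<le> b" using cd by linarith
  with F obtain m where m: "\<And>x. x \<in> {a..b} \<Longrightarrow> F x = F a + m * (x - a)"
    unfolding affine_between_iff_slope[OF \<open>a \<le> b\<close>] by blast
  have "F x = F c + m * (x - c)" if "x \<in> {c..d}" for x
    using m[of x] m[of c] that cd by (simp add: algebra_simps)
  then show ?thesis unfolding affine_between_iff_slope[OF cd(2)] by blast
qed

lemma affine_between_comp:
  "affine_between G a b \<Longrightarrow> affine_between F (G a) (G b) \<Longrightarrow> affine_between (F \<circ> G) a b"
  unfolding affine_between_def by simp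

lemma affine_between_inv:
  assumes "monotone_lift F f" "affine_between F a b"
  shows "affine_between (inv_into UNIV F) (F a) (F b)"
  using assms(2) monotone_lift_inv(2)[OF assms(1)] unfolding affine_between_def by metis

text \<open>Two bi-infinite sequences that advance by \<open>1\<close> after the same number of steps are related
  by a lift that interpolates linearly.\<close>
lemma piecewise_linear_interpolation:
  fixes v w :: "int \<Rightarrow> real"
  assumes v: "strict_mono v" "\<And>i. v (i + int n) = v i + 1"
    and w: "strict_mono w" "\<And>i. w (i + int n) = w i + 1"
  obtains F where "strict_mono F" "surj F" "\<And>x. F (x + 1) = F x + 1" "\<And>i. F (v i) = w i"
    "\<And>i. affine_between F (v i) (v (i + 1))"
proof -
  have vl: "v i < v j \<longleftrightarrow> i < j" "v i \<le> v j \<longleftrightarrow> i \<le> j" for i j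
    using strict_mono_less[OF v(1)] strict_mono_less_eq[OF v(1)] by blast+
  have wl: "w i < w j \<longleftrightarrow> i < j" "w i \<le> w j \<longleftrightarrow> i \<le> j" for i j
    using strict_mono_less[OF w(1)] strict_mono_less_eq[OF w(1)] by blast+
  have vpos: "v (i + 1) - v i > 0" and wpos: "w (i + 1) - w i > 0" for i
    using vl(1)[of i "i + 1"] wl(1)[of i "i + 1"] by simp_all
  define idx where "idx x = (SOME i. v i \<le> x \<and> x < v (i + 1))" for x
  have idx: "v (idx x) \<le> x \<and> x < v (idx x + 1)" for x
  proof -
    obtain i where "v i \<le> x" "x < v (i + 1)"
      by (rule strict_mono_int_locate[of v n, OF v])
    then have "v i \<le> x \<and> x < v (i + 1)" by blast
    then show ?thesis unfolding idx_def by (rule someI)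
  qed
  have idx_eq: "idx x = i" if "v i \<le> x" "x < v (i + 1)" for x i
  proof -
    have "v (idx x) < v (i + 1)" "v i < v (idx x + 1)"
      using that idx[of x] by linarith+
    then show ?thesis unfolding vl by linarith
  qed
  define seg where "seg i x = w i + (x - v i) / (v (i + 1) - v i) * (w (i + 1) - w i)" for i x
  define F where "F x = seg (idx x) x" for x
  have seg_ends: "seg i (v i) = w i" "seg i (v (i + 1)) = w (i + 1)" for i
    unfolding seg_def using vpos[of i] by simp_all
  have Fv: "F (v i) = w i" for i
    using idx_eq[of i "v i"] vl(1)[of i "i + 1"] seg_ends(1) unfolding F_def by simp
  have Fseg: "F x = seg i x" if "v i \<le> x" "x \<le> v (i + 1)" for i x
    using idx_eq[of i x] that Fv[of "i + 1"] seg_ends(2)[of i] unfolding F_def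
    by (cases "x = v (i + 1)") auto
  have seg_mono: "seg i x < seg i y \<longleftrightarrow> x < y" for i x y
    unfolding seg_def using vpos[of i] wpos[of i]
    by (simp add: mult_less_cancel_right divide_less_cancel)
  have "strict_mono F"
  proof (rule strict_monoI)
    fix x y :: real
    assume xy: "x < y"
    have "v (idx x) < v (idx y + 1)" using xy idx[of x] idx[of y] by linarith
    then have "idx x \<le> idx y" unfolding vl by simp
    then consider "idx x = idx y" | "idx x + 1 \<le> idx y" by linarith
    then show "F x < F y"
    proof cases
      case 1
      then show ?thesis unfolding F_def using seg_mono xy by simp
    next
      case 2
      have "F x < w (idx x + 1)"
        unfolding F_def using seg_mono[of "idx x" x "v (idx x + 1)"] idx[of x] seg_ends by simp
      also have "\<dots> \<le> w (idx y)" unfolding wl by (rule 2)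
      also have "\<dots> \<le> F y"
        unfolding F_def using seg_mono[of "idx y" y "v (idx y)"] idx[of y] seg_ends(1)[of "idx y"]
        by linarith
      finally show ?thesis .
    qed
  qed
  moreover have "\<exists>x. F x = y" for y
  proof -
    obtain j where j: "w j \<le> y" "y < w (j + 1)"
      by (rule strict_mono_int_locate[of w n, OF w])
    define t where "t = (y - w j) / (w (j + 1) - w j)"
    have t: "0 \<le> t" "t \<le> 1" unfolding t_def using j wpos[of j] by simp_all
    have x: "v j \<le> v j + t * (v (j + 1) - v j)" "v j + t * (v (j + 1) - v j) \<le> v (j + 1)"
      using t vpos[of j] by (intro segment_bounds; simp)+
    have "F (v j + t * (v (j + 1) - v j)) = y"
      unfolding Fseg[OF x] unfolding seg_def using vpos[of j] wpos[of j] by (simp add: t_def)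
    then show ?thesis by blast
  qed
  then have "surj F" by (metis surj_def)
  moreover have "F (x + 1) = F x + 1" for x
  proof -
    have s: "idx x + int n + 1 = (idx x + 1) + int n" by simp
    have "idx (x + 1) = idx x + int n"
      by (rule idx_eq) (use idx[of x] in \<open>simp_all only: s v(2), simp_all\<close>)
    then show ?thesis unfolding F_def seg_def s v(2) w(2) by (simp add: s v(2) w(2))
  qed
  moreover have "affine_between F (v i) (v (i + 1))" for i
    unfolding affine_between_def
  proof
    fix t :: real
    assume t: "t \<in> {0..1}"
    have x: "v i \<le> v i + t * (v (i + 1) - v i)" "v i + t * (v (i + 1) - v i) \<le> v (i + 1)"
      using t vpos[of i] by (intro segment_bounds; simp)+
    show "F (v i + t * (v (i + 1) - v i)) = F (v i) + t * (F (v (i + 1)) - F (v i))"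
      unfolding Fseg[OF x] Fv unfolding seg_def using vpos[of i] by simp
  qed
  ultimately show ?thesis using Fv by (intro that[of F])
qed

section \<open>Rearrangements preserve the lamination\<close>

text \<open>Directed circle edges go to directed circle edges, so the image of the next vertex is the next
  vertex of the image. Hence the isomorphism is a shift \<open>s\<close> of the enumerations; negative
  indices are reached from the nonnegative ones by going around the circle.\<close>
lemma diagram_isomorphism_rotates:
  fixes v w :: "int \<Rightarrow> real"
  assumes v: "strict_mono v" "range v = {x. circ x \<in> \<Union>D}" "\<And>i. v (i + int n) = v i + 1"
    and w: "strict_mono w" "range w = {x. circ x \<in> \<Union>R}" "\<And>i. w (i + int n) = w i + 1"
    and n: "0 < n" and iso: "diagram_isomorphism \<phi> D R"
  obtains s where "\<And>i. \<phi> (circ (v i)) = circ (w (i + s))"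
proof -
  have cv: "circ (v (i + int n * k)) = circ (v i)" and cw: "circ (w (i + int n * k)) = circ (w i)" for i k
    unfolding shift_multiple[of v "int n", OF v(3)] shift_multiple[of w "int n", OF w(3)] by simp_all
  have next_w: "\<phi> (circ (v (i + 1))) = circ (w (j + 1))" if ij: "\<phi> (circ (v i)) = circ (w j)" for i j
  proof -
    have "circle_interval D (v i) (v (i + 1))"
      unfolding circle_interval_enum[OF v(1,2)] by (rule exI[of _ i]) simp
    then have "(circ (v i), circ (v (i + 1))) \<in> circle_edges D"
      unfolding circle_edges_def by auto
    then have "(\<phi> (circ (v i)), \<phi> (circ (v (i + 1)))) \<in> map_prod \<phi> \<phi> ` circle_edges D"
      by (metis map_prod_imageI)
    then have "(\<phi> (circ (v i)), \<phi> (circ (v (i + 1)))) \<in> circle_edges R"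
      using iso unfolding diagram_isomorphism_def by simp
    then obtain a b where ab: "circle_interval R a b" "\<phi> (circ (v i)) = circ a" "\<phi> (circ (v (i + 1))) = circ b"
      unfolding circle_edges_def by blast
    have "\<exists>l. a = w l \<and> b = w (l + 1)"
      using ab(1) unfolding circle_interval_enum[OF w(1,2)] .
    then obtain l where l: "a = w l \<and> b = w (l + 1)" ..
    have "circ (w l) = circ (w j)" using ij ab(2) l by simp
    then obtain k where "w l = w j + of_int k" by (rule circ_eqE)
    then have "w l = w (j + int n * k)" by (simp only: shift_multiple[of w "int n", OF w(3)])
    then have "l = j + int n * k" by (simp only: strict_mono_eq[OF w(1)])
    then have "l + 1 = (j + 1) + int n * k" by simp
    then have "circ (w (l + 1)) = circ (w (j + 1))" by (simp only: cw)
    then show ?thesis using ab(3) l by simp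
  qed
  have "circ (v 0) \<in> \<Union>D" using v(2) by (metis mem_Collect_eq rangeI)
  then have "\<phi> (circ (v 0)) \<in> \<Union>R" using iso unfolding diagram_isomorphism_def by (metis bij_betwE)
  moreover obtain y where y: "\<phi> (circ (v 0)) = circ y" by (rule circ_cases)
  ultimately have "y \<in> range w" using w(2) by simp
  then obtain s where "y = w s" by (rule rangeE)
  with y have s: "\<phi> (circ (v 0)) = circ (w s)" by simp
  have nonneg: "\<phi> (circ (v (int i))) = circ (w (int i + s))" for i
  proof (induction i)
    case 0
    show ?case using s by simp
  next
    case (Suc i)
    have "\<phi> (circ (v (int i + 1))) = circ (w (int i + s + 1))" by (rule next_w[OF Suc])
    then show ?case by (simp add: algebra_simps)
  qed
  have "\<phi> (circ (v i)) = circ (w (i + s))" for i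
  proof -
    \<comment> \<open>Adding enough full turns makes the index nonnegative.\<close>
    define j where "j = nat (i + int n * \<bar>i\<bar>)"
    have "1 * \<bar>i\<bar> \<le> int n * \<bar>i\<bar>" using n by (intro mult_right_mono) simp_all
    then have j: "int j = i + int n * \<bar>i\<bar>" unfolding j_def by simp
    have "\<phi> (circ (v i)) = \<phi> (circ (v (int j)))" unfolding j cv ..
    also have "\<dots> = circ (w (int j + s))" by (rule nonneg)
    also have "int j + s = (i + s) + int n * \<bar>i\<bar>" using j by simp
    finally show ?thesis unfolding cw .
  qed
  then show ?thesis by (rule that)
qed

text \<open>Replaces the combinatorial isomorphism by a lift of \<open>f\<close>. The conclusion is symmetric in \<open>D\<close> and
  \<open>R\<close> up to inverting the lift, so that facts about \<open>f\<close> also apply to its inverse.\<close>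
lemma T_B_lift:
  assumes "f \<in> T_B"
  obtains F D R where "arc_diagram D" "arc_diagram R" "monotone_lift F f" "(`) f ` D = R"
    "\<And>a b. circle_interval D a b \<Longrightarrow> circle_interval R (F a) (F b) \<and> affine_between F a b"
proof -
  obtain D R \<phi> where D: "arc_diagram D" and R: "arc_diagram R"
    and iso: "diagram_isomorphism \<phi> D R" and ind: "induced_by f \<phi> D R"
    using assms unfolding T_B_def by blast
  obtain v :: "int \<Rightarrow> real" where v: "strict_mono v" "range v = {x. circ x \<in> \<Union>D}" "0 < card (\<Union>D)"
    "\<And>i. v (i + int (card (\<Union>D))) = v i + 1"
    by (rule lamination_subset_enumeration[of D]) (use arc_diagram_imp_standard[OF D] in simp_all)
  obtain w0 :: "int \<Rightarrow> real" where w0: "strict_mono w0" "range w0 = {x. circ x \<in> \<Union>R}" "0 < card (\<Union>R)"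
    "\<And>i. w0 (i + int (card (\<Union>R))) = w0 i + 1"
    by (rule lamination_subset_enumeration[of R]) (use arc_diagram_imp_standard[OF R] in simp_all)
  have card: "card (\<Union>R) = card (\<Union>D)"
    using iso unfolding diagram_isomorphism_def by (metis bij_betw_same_card)
  obtain s where s: "\<And>i. \<phi> (circ (v i)) = circ (w0 (i + s))"
    by (rule diagram_isomorphism_rotates[OF v(1,2,4) w0(1,2) w0(4)[unfolded card] v(3) iso])
      (rule that)
  define w where "w i = w0 (i + s)" for i
  have wmono: "strict_mono w"
    using strict_mono_less[OF w0(1)] unfolding w_def by (auto intro: strict_monoI)
  have wper: "w (i + int (card (\<Union>D))) = w i + 1" for i
    using w0(4)[of "i + s"] unfolding w_def card by (simp add: algebra_simps)
  have wint: "circle_interval R (w i) (w (i + 1))" for i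
    unfolding circle_interval_enum[OF w0(1,2)] w_def
    by (rule exI[of _ "i + s"]) (simp add: algebra_simps)
  have vint: "circle_interval D (v i) (v (i + 1))" for i
    unfolding circle_interval_enum[OF v(1,2)] by (rule exI[of _ i]) simp
  obtain F where F: "strict_mono F" "surj F" "\<And>x. F (x + 1) = F x + 1" "\<And>i. F (v i) = w i"
    "\<And>i. affine_between F (v i) (v (i + 1))"
    by (rule piecewise_linear_interpolation[of v "card (\<Union>D)", OF v(1,4) wmono wper]) (rule that)
  have lift: "f (circ x) = circ (F x)" for x
  proof -
    obtain i where i: "v i \<le> x" "x < v (i + 1)" by (rule strict_mono_int_locate[of v "card (\<Union>D)", OF v(1,4)])
    define t where "t = (x - v i) / (v (i + 1) - v i)"
    have t: "t \<in> {0..1}" "x = v i + t * (v (i + 1) - v i)"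
      unfolding t_def using i by simp_all
    have "f (circ (v i + t * (v (i + 1) - v i))) = circ (w i + t * (w (i + 1) - w i))"
      using ind vint[of i] wint[of i] s[of i, folded w_def] s[of "i + 1", folded w_def] t(1)
      unfolding induced_by_def by blast
    moreover have "F (v i + t * (v (i + 1) - v i)) = w i + t * (w (i + 1) - w i)"
      using F(5)[of i] t(1) unfolding affine_between_def F(4) by blast
    ultimately show ?thesis unfolding t(2)[symmetric] by simp
  qed
  have lift_F: "monotone_lift F f" unfolding monotone_lift_def using F lift by blast
  have f_vertex: "f p = \<phi> p" if "p \<in> \<Union>D" for p
  proof -
    obtain x where x: "p = circ x" by (rule circ_cases)
    then have "x \<in> range v" using that v(2) by simp
    then obtain i where "x = v i" by (rule rangeE)
    then show ?thesis using lift[of x] s[of i] F(4)[of i] unfolding x w_def by simp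
  qed
  have "(`) f ` D = (\<lambda>A. \<phi> ` A) ` D"
    by (rule image_cong[OF refl], rule image_cong[OF refl]) (use f_vertex in blast)
  also have "\<dots> = R" using iso unfolding diagram_isomorphism_def by blast
  finally have img: "(`) f ` D = R" .
  have "circle_interval R (F a) (F b) \<and> affine_between F a b" if "circle_interval D a b" for a b
  proof -
    have "\<exists>i. a = v i \<and> b = v (i + 1)"
      using that unfolding circle_interval_enum[OF v(1,2)] .
    then obtain i where "a = v i \<and> b = v (i + 1)" ..
    then show ?thesis using wint[of i] F(4,5) by simp
  qed
  then show ?thesis by (rule that[OF D R lift_F img])
qed

text \<open>Relative to the centre of a standard interval of scale \<open>m\<close> and measured in its length, the arcs
  inside it are described by a formula that involves neither \<open>m\<close> nor the centre. In coordinates the map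
  changes the scale from \<open>m\<close> to \<open>n\<close> and shifts the numerators \<open>6 k \<plusminus> 1\<close> by a multiple of \<open>6\<close>,
  which uses that the levels of arcs inside the interval exceed \<open>m\<close>.\<close>
lemma standard_to_standard_arc:
  assumes F: "affine_between F a b"
    and ab: "standard_interval a b" and cd: "standard_interval (F a) (F b)"
    and x: "a < x" "x < b" "circ x \<in> basilica_arc k j"
  obtains y where "a < y" "y < b" "basilica_arc k j = {circ x, circ y}"
    "{circ (F x), circ (F y)} \<in> basilica_lamination"
proof -
  obtain c m where cm: "1 \<le> m" "a = of_int (3 * c - 1) / (3 * 2 ^ m)" "b = of_int (3 * c + 1) / (3 * 2 ^ m)"
    using ab unfolding standard_interval_def by blast
  obtain d n where dn: "1 \<le> n" "F a = of_int (3 * d - 1) / (3 * 2 ^ n)" "F b = of_int (3 * d + 1) / (3 * 2 ^ n)"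
    using cd unfolding standard_interval_def by blast
  have lin: "F z = of_int d / 2 ^ n + 2 ^ m / 2 ^ n * (z - of_int c / 2 ^ m)" if "a \<le> z" "z \<le> b" for z
  proof -
    have L1: "b - a = 2 / (3 * 2 ^ m)" unfolding cm(2,3) by (simp add: field_simps)
    have L2: "F b - F a = 2 / (3 * 2 ^ n)" unfolding dn(2,3) by (simp add: field_simps)
    have lt: "a < b" using ab standard_interval_length(1) by blast
    define t where "t = (z - a) / (b - a)"
    have t: "t \<in> {0..1}" "z = a + t * (b - a)" unfolding t_def using that lt by simp_all
    have "F z = F a + t * (F b - F a)" using F t unfolding affine_between_def by metis
    also have "\<dots> = F a + (z - a) * (2 ^ m / 2 ^ n)" unfolding t_def L1 L2 by (simp add: field_simps)
    also have "\<dots> = of_int d / 2 ^ n + 2 ^ m / 2 ^ n * (z - of_int c / 2 ^ m)"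
      unfolding dn(2) unfolding cm(2) by (simp add: field_simps)
    finally show ?thesis .
  qed
  obtain e where e: "e = 1 \<or> e = -1" "circ x = circ (of_int (6 * k + e) / (3 * 2 ^ j))"
    "basilica_arc k j = {circ (of_int (6 * k + e) / (3 * 2 ^ j)), circ (of_int (6 * k - e) / (3 * 2 ^ j))}"
    using x(3) by (rule basilica_arc_memE)
  obtain t where xt: "x = of_int (6 * k + e) / (3 * 2 ^ j) + of_int t"
    using e(2) by (rule circ_eqE)
  have mj: "m < j"
  proof (rule ccontr)
    assume "\<not> m < j"
    then have p: "(2::real) ^ m = 2 ^ (m - j) * 2 ^ j" by (simp flip: power_add)
    define M where "M = (6 * k + e) * 2 ^ (m - j) + 3 * 2 ^ m * t"
    have xM: "x = of_int M / (3 * 2 ^ m)" unfolding xt M_def by (simp add: p field_simps)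
    have "3 * c - 1 < M" "M < 3 * c + 1"
      using x(1,2) unfolding xM cm by (simp_all add: divide_less_cancel)
    then have "M = 3 * c" by linarith
    then have "3 dvd (6 * k + e) * 2 ^ (m - j)"
      unfolding M_def by (metis dvd_add_left_iff dvd_triv_left mult.assoc)
    then have "3 dvd 6 * k + e" by simp
    with e(1) show False by presburger
  qed
  define r where "r = j - Suc m"
  have j: "j = m + Suc r" unfolding r_def using mj by simp
  \<comment> \<open>The full turns between \<open>x\<close> and the representative of the arc are absorbed into the index.\<close>
  define K where "K = k + 2 ^ (j - 1) * t"
  have pj: "(2::int) ^ j = 2 * 2 ^ (j - 1)" unfolding j by simp
  have xK: "x = of_int (6 * K + e) / (3 * 2 ^ j)"
  proof -
    have "6 * K + e = 6 * k + e + 3 * 2 ^ j * t" unfolding K_def pj by (simp add: algebra_simps)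
    then have "real_of_int (6 * K + e) = of_int (6 * k + e + 3 * 2 ^ j * t)" by simp
    then show ?thesis unfolding xt by (simp add: field_simps)
  qed
  define y where "y = real_of_int (6 * K - e) / (3 * 2 ^ j)"
  have yk: "y = of_int (6 * k - e) / (3 * 2 ^ j) + of_int t"
  proof -
    have "6 * K - e = 6 * k - e + 3 * 2 ^ j * t" unfolding K_def pj by (simp add: algebra_simps)
    then have "real_of_int (6 * K - e) = of_int (6 * k - e + 3 * 2 ^ j * t)" by simp
    then show ?thesis unfolding y_def by (simp add: field_simps)
  qed
  have arc_xy: "basilica_arc k j = {circ x, circ y}" unfolding e(3) xt yk circ_add_int ..
  define lo hi where "lo = (3 * c - 1) * 2 ^ Suc r" and "hi = (3 * c + 1) * 2 ^ Suc r"
  have ends: "a = of_int lo / (3 * 2 ^ j)" "b = of_int hi / (3 * 2 ^ j)"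
    unfolding cm j lo_def hi_def by (simp_all add: power_add field_simps)
  have "lo < 6 * K + e" "6 * K + e < hi"
    using x(1,2) unfolding ends xK by (simp_all add: divide_less_cancel del: of_int_mult of_int_add of_int_diff)
  moreover have "even lo" "even hi" unfolding lo_def hi_def by simp_all
  moreover have "\<not> 3 dvd lo" "\<not> 3 dvd hi"
    unfolding lo_def hi_def three_dvd_mult_power_two by presburger+
  ultimately have "lo < 6 * K - e" "6 * K - e < hi"
    using e(1) by presburger+
  then have ay: "a < y" "y < b"
    unfolding ends y_def by (simp_all add: divide_strict_right_mono del: of_int_mult of_int_add of_int_diff)
  \<comment> \<open>In numerators, the centres of the two intervals differ by \<open>6 (d - c) 2\<^sup>r\<close>.\<close>
  define K' where "K' = K + (d - c) * 2 ^ r"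
  have "F x = of_int (6 * K' + e) / (3 * 2 ^ (n + Suc r))"
    unfolding lin[OF less_imp_le[OF x(1)] less_imp_le[OF x(2)]] unfolding xK K'_def j
    by (simp add: power_add field_simps)
  moreover have "F y = of_int (6 * K' - e) / (3 * 2 ^ (n + Suc r))"
    unfolding lin[OF less_imp_le[OF ay(1)] less_imp_le[OF ay(2)]] unfolding y_def K'_def j
    by (simp add: power_add field_simps)
  ultimately have "{circ (F x), circ (F y)} = basilica_arc K' (n + Suc r)"
    using e(1) unfolding basilica_arc_def by (auto simp: insert_commute)
  then have "{circ (F x), circ (F y)} \<in> basilica_lamination" unfolding basilica_lamination_eq by blast
  with ay arc_xy show ?thesis by (rule that)
qed

text \<open>An arc outside the diagram has both endpoints in the interior of one interval, where the
  rearrangement is affine between standard intervals.\<close>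
lemma rearrangement_maps_lamination:
  assumes D: "arc_diagram D" and R: "arc_diagram R" and F: "monotone_lift F f"
    and DR: "(`) f ` D = R"
    and aff: "\<And>a b. circle_interval D a b \<Longrightarrow> circle_interval R (F a) (F b) \<and> affine_between F a b"
    and A: "A \<in> basilica_lamination"
  shows "f ` A \<in> basilica_lamination"
proof (cases "A \<in> D")
  case True
  then have "f ` A \<in> R" using DR by blast
  then show ?thesis using arc_diagram_imp_standard[OF R] by blast
next
  case False
  note Dstd = arc_diagram_imp_standard[OF D] and Rstd = arc_diagram_imp_standard[OF R]
  obtain k j where kj: "A = basilica_arc k j" using A unfolding basilica_lamination_eq by blast
  obtain p where p: "p \<in> A" unfolding kj basilica_arc_def by blast
  obtain x where px: "p = circ x" by (rule circ_cases)
  have xD: "circ x \<notin> \<Union>D"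
    using lamination_disjoint[OF A _ p] False Dstd px by blast
  obtain v :: "int \<Rightarrow> real" where v: "strict_mono v" "range v = {x. circ x \<in> \<Union>D}" "0 < card (\<Union>D)"
    "\<And>i. v (i + int (card (\<Union>D))) = v i + 1"
    using Dstd lamination_subset_enumeration[of D] by metis
  obtain i where i: "v i \<le> x" "x < v (i + 1)"
    by (rule strict_mono_int_locate[of v "card (\<Union>D)", OF v(1,4)])
  have vi: "circle_interval D (v i) (v (i + 1))"
    unfolding circle_interval_enum[OF v(1,2)] by (rule exI[of _ i]) simp
  have "circ (v i) \<in> \<Union>D" using v(2) by (metis mem_Collect_eq rangeI)
  then have "v i \<noteq> x" using xD by metis
  with i have x: "v i < x" "x < v (i + 1)" by simp_all
  have "standard_interval (v i) (v (i + 1))" "standard_interval (F (v i)) (F (v (i + 1)))"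
    using Dstd Rstd vi aff by blast+
  then obtain y where y: "basilica_arc k j = {circ x, circ y}"
    "{circ (F x), circ (F y)} \<in> basilica_lamination"
    using standard_to_standard_arc[of F "v i" "v (i + 1)" x k j] aff[OF vi] x p px kj by metis
  have "f ` A = {circ (F x), circ (F y)}"
    unfolding kj y(1) by (simp add: monotone_liftD(4)[OF F])
  then show ?thesis using y(2) by simp
qed

text \<open>The primary arc spans \<open>(b - a) / 2 < 1/2\<close>, which for an arc of level at least \<open>2\<close> means
  that it is the shorter side of the arc; a span of level \<open>0\<close> or \<open>1\<close> would have length \<open>1/3\<close> and lead to
  \<open>b - a = 2/3\<close>. Prolonging the arc by half of its span on both sides gives back \<open>[a, b]\<close>.\<close>
lemma arc_ratio_imp_standard:
  assumes ab: "a < b" "b < a + 1"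
    and arc: "primary_arc a b \<in> basilica_lamination" "primary_arc a b \<notin> arcs_upto 1"
  shows "standard_interval a b"
proof -
  define p q where "p = a + (b - a) / 4" and "q = b - (b - a) / 4"
  have len: "q - p = (b - a) / 2" unfolding p_def q_def by (simp add: field_simps)
  have l: "0 < q - p" "q - p < 1/2" using ab unfolding len by simp_all
  obtain k j where kj: "primary_arc a b = basilica_arc k j"
    using arc(1) unfolding basilica_lamination_eq by blast
  have j2: "2 \<le> j" using arc(2) unfolding kj arc_in_arcs_upto_iff by simp
  have pq: "{circ p, circ q} = basilica_arc k j" using kj unfolding primary_arc_def p_def q_def .
  obtain e where e: "e = 1 \<or> e = -1" "circ p = circ (of_int (6 * k + e) / (3 * 2 ^ j))"
    "basilica_arc k j = {circ (of_int (6 * k + e) / (3 * 2 ^ j)), circ (of_int (6 * k - e) / (3 * 2 ^ j))}"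
    using basilica_arc_memE[of "circ p" k j] pq by blast
  have "circ p \<noteq> circ q" using circ_inj_near[of p q] l by auto
  then have cq: "circ q = circ (of_int (6 * k - e) / (3 * 2 ^ j))"
    using pq e(2,3) by (metis doubleton_eq_iff)
  obtain s where s: "p = of_int (6 * k + e) / (3 * 2 ^ j) + of_int s" using e(2) by (rule circ_eqE)
  obtain t where t: "q = of_int (6 * k - e) / (3 * 2 ^ j) + of_int t" using cq by (rule circ_eqE)
  define \<delta> :: real where "\<delta> = 2 / (3 * 2 ^ j)"
  have diff: "q - p = of_int (t - s) - of_int e * \<delta>"
    unfolding s t \<delta>_def by (simp add: field_simps)
  have "(4::real) = 2 ^ 2" by simp
  also have "\<dots> \<le> 2 ^ j" using j2 by (intro power_increasing) simp_all
  finally have small: "\<delta> \<le> 1/6" "0 < \<delta>"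
    unfolding \<delta>_def by (simp_all add: field_simps)
  have em: "e = -1 \<and> t = s"
  proof (cases "e = 1")
    case True
    then have "real_of_int (t - s) < of_int 1" "real_of_int 0 < of_int (t - s)"
      using diff l small by simp_all
    then have False unfolding of_int_less_iff by linarith
    then show ?thesis ..
  next
    case False
    with e(1) have "e = -1" by simp
    moreover from this have "real_of_int (t - s) < of_int 1" "real_of_int (- 1) < of_int (t - s)"
      using diff l small by simp_all
    then have "t = s" unfolding of_int_less_iff by linarith
    ultimately show ?thesis by simp
  qed
  define K where "K = k + 2 ^ (j - 1) * s"
  define i where "i = j - 2"
  have j: "j = i + 2" unfolding i_def using j2 by simp
  have pq_eq: "p = of_int (6 * K - 1) / (3 * 2 ^ j)" "q = of_int (6 * K + 1) / (3 * 2 ^ j)"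
    unfolding s t K_def j using em by (simp_all add: field_simps)
  have ab_eq: "a = p - (q - p) / 2" "b = q + (q - p) / 2" unfolding p_def q_def by (simp_all add: field_simps)
  show ?thesis
  proof (rule standard_intervalI[of "i + 1" _ K])
    show "a = of_int (3 * K - 1) / (3 * 2 ^ (i + 1))" "b = of_int (3 * K + 1) / (3 * 2 ^ (i + 1))"
      unfolding ab_eq pq_eq j by (simp_all add: field_simps)
  qed simp
qed

section \<open>Maps preserving the lamination\<close>

text \<open>The criterion of the theorem without derivatives: \<open>B\<close> is a finite set of arc endpoints
  that contains all breakpoints.\<close>
definition basilica_map :: "(circle \<Rightarrow> circle) \<Rightarrow> bool" where
  "basilica_map f \<longleftrightarrow> preserves_basilica_rel f \<and>
     (\<exists>F B. monotone_lift F f \<and> finite B \<and> B \<subseteq> \<Union>basilica_lamination \<and>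
        (\<forall>a b. a < b \<and> (\<forall>x. a < x \<and> x < b \<longrightarrow> circ x \<notin> B) \<longrightarrow> affine_between F a b))"

lemma preserves_basilica_relI:
  assumes "bij f"
    and "\<And>A. A \<in> basilica_lamination \<Longrightarrow> f ` A \<in> basilica_lamination"
    and "\<And>A. A \<in> basilica_lamination \<Longrightarrow> inv_into UNIV f ` A \<in> basilica_lamination"
  shows "preserves_basilica_rel f"
  unfolding preserves_basilica_rel_def basilica_rel_def
proof (intro allI)
  fix p q
  have "{p, q} \<in> basilica_lamination \<longleftrightarrow> {f p, f q} \<in> basilica_lamination"
    using assms(2)[of "{p, q}"] assms(3)[of "{f p, f q}"] bij_is_inj[OF assms(1)] by auto
  moreover have "p = q \<longleftrightarrow> f p = f q" using bij_is_inj[OF assms(1)] by (simp add: inj_eq)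
  ultimately show "(p = q \<or> {p, q} \<in> basilica_lamination) \<longleftrightarrow> (f p = f q \<or> {f p, f q} \<in> basilica_lamination)"
    by simp
qed

lemma preserves_image_lamination:
  assumes "bij f" "preserves_basilica_rel f"
  shows "f ` A \<in> basilica_lamination \<longleftrightarrow> A \<in> basilica_lamination"
proof -
  have *: "{p, q} \<in> basilica_lamination \<longleftrightarrow> {f p, f q} \<in> basilica_lamination" if "p \<noteq> q" for p q
    using assms that unfolding preserves_basilica_rel_def basilica_rel_def
    by (metis bij_is_inj inj_eq)
  have nonempty: "{} \<notin> basilica_lamination" unfolding basilica_lamination_eq basilica_arc_def by blast
  show ?thesis
  proof
    assume fA: "f ` A \<in> basilica_lamination"
    then obtain p where p: "p \<in> A" using nonempty by fastforce
    obtain r where r: "f ` A = {f p, r}" "f p \<noteq> r"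
      using lamination_doubleton[OF fA] p by (metis imageI)
    then obtain q where q: "q \<in> A" "r = f q" by (metis imageE insertCI)
    have "f ` A = f ` {p, q}" using r q by simp
    then have "A = {p, q}" using bij_is_inj[OF assms(1)] inj_image_eq_iff by metis
    moreover have "{f p, f q} \<in> basilica_lamination" using fA unfolding r(1) q(2) .
    moreover have "p \<noteq> q" using r(2) q(2) by blast
    ultimately show "A \<in> basilica_lamination" using *[of p q] by simp
  next
    assume A: "A \<in> basilica_lamination"
    then obtain p where p: "p \<in> A" using nonempty by fastforce
    obtain q where q: "A = {p, q}" "p \<noteq> q" using lamination_doubleton[OF A p] .
    then show "f ` A \<in> basilica_lamination" using * A by simp
  qed
qed

text \<open>The vertices of the source diagram serve as the set of possible breakpoints. The inverse
  satisfies the same hypotheses with the diagrams exchanged, hence maps arcs to arcs as well.\<close>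
lemma T_B_imp_basilica_map:
  assumes "f \<in> T_B"
  shows "basilica_map f"
proof -
  obtain F D R where D: "arc_diagram D" and R: "arc_diagram R" and F: "monotone_lift F f"
    and DR: "(`) f ` D = R"
    and aff: "\<And>a b. circle_interval D a b \<Longrightarrow> circle_interval R (F a) (F b) \<and> affine_between F a b"
    using T_B_lift[OF assms] by metis
  let ?G = "inv_into UNIV F" and ?g = "inv_into UNIV f"
  have bij: "bij f" using F by (rule monotone_lift_bij)
  have GR: "(`) ?g ` R = D"
    unfolding DR[symmetric] using bij_is_inj[OF bij] by (simp add: image_image image_inv_f_f)
  obtain v :: "int \<Rightarrow> real" where v: "strict_mono v" "range v = {x. circ x \<in> \<Union>D}" "0 < card (\<Union>D)"
    "\<And>i. v (i + int (card (\<Union>D))) = v i + 1"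
    using arc_diagram_imp_standard[OF D] lamination_subset_enumeration[of D] by metis
  have int: "circle_interval D (v i) (v (i + 1))" for i
    unfolding circle_interval_enum[OF v(1,2)] by (rule exI[of _ i]) simp
  have Gaff: "circle_interval D (?G a) (?G b) \<and> affine_between ?G a b" if "circle_interval R a b" for a b
  proof -
    define z where "z = ?G ((a + b) / 2)"
    have ab: "a < b" using that unfolding circle_interval_def by blast
    obtain i where i: "v i \<le> z" "z < v (i + 1)"
      by (rule strict_mono_int_locate[of v "card (\<Union>D)", OF v(1,4)])
    have Fz: "F z = (a + b) / 2" unfolding z_def by (rule monotone_lift_inv(3)[OF F])
    have Fi: "F (v i) \<le> (a + b) / 2" "(a + b) / 2 < F (v (i + 1))"
      using i strict_mono_less_eq[OF monotone_liftD(1)[OF F]] monotone_lift_less[OF F] Fz by metis+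
    have "max (F (v i)) a < min (F (v (i + 1))) b" using Fi ab by simp
    then have "F (v i) = a" "F (v (i + 1)) = b"
      using circle_intervals_overlap[OF _ that] aff[OF int] by blast+
    then show ?thesis
      using int[of i] affine_between_inv[OF F] aff[OF int[of i]] monotone_lift_inv(2)[OF F] by metis
  qed
  have "preserves_basilica_rel f"
    using bij rearrangement_maps_lamination[OF D R F DR aff]
      rearrangement_maps_lamination[OF R D monotone_lift_inv(1)[OF F] GR Gaff]
    by (rule preserves_basilica_relI)
  moreover have "finite (\<Union>D)" using v(3) card_ge_0_finite by blast
  moreover have "\<Union>D \<subseteq> \<Union>basilica_lamination" using arc_diagram_imp_standard[OF D] by blast
  moreover have "affine_between F a b"
    if ab: "a < b" "\<forall>x. a < x \<and> x < b \<longrightarrow> circ x \<notin> \<Union>D" for a b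
  proof -
    obtain i where i: "v i \<le> a" "a < v (i + 1)"
      by (rule strict_mono_int_locate[of v "card (\<Union>D)", OF v(1,4)])
    have "circ (v (i + 1)) \<in> \<Union>D" using v(2) by (metis mem_Collect_eq rangeI)
    then have "b \<le> v (i + 1)" using ab i by (metis not_le)
    then show ?thesis using aff[OF int[of i]] affine_between_subinterval i ab(1) by (metis less_imp_le)
  qed
  ultimately show ?thesis
    unfolding basilica_map_def using F
    by (intro conjI exI[of _ F] exI[of _ "\<Union>D"] allI impI) (assumption | elim conjE)+
qed

lemma connected_component_image_compl:
  assumes f: "continuous_on UNIV f" "inj f" and pq: "connected_component (- A) p q"
  shows "connected_component (- (f ` A)) (f p) (f q)"
proof -
  obtain T where T: "connected T" "T \<subseteq> - A" "p \<in> T" "q \<in> T"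
    using pq unfolding connected_component_def by blast
  have "connected (f ` T)"
    using T(1) f(1) by (meson connected_continuous_image continuous_on_subset subset_UNIV)
  moreover have "f ` T \<subseteq> - (f ` A)" using T(2) f(2) by (auto dest: injD)
  ultimately show ?thesis unfolding connected_component_def using T(3,4) by blast
qed

text \<open>Homeomorphisms map the components of the circle minus an arc to those of the circle minus the
  image arc.\<close>
lemma same_face_image:
  assumes F: "monotone_lift F f"
  shows "same_face ((`) f ` D) (f p) (f q) \<longleftrightarrow> same_face D p q"
proof -
  note hom = monotone_lift_homeomorphism[OF F] and bij = monotone_lift_bij[OF F]
  let ?g = "inv_into UNIV f"
  have cf: "continuous_on UNIV f" and cg: "continuous_on UNIV ?g"
    using hom by (auto simp: homeomorphism_def)
  have ig: "inj ?g" using bij by (simp add: bij_imp_bij_inv bij_is_inj)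
  have gf: "?g (f x) = x" for x using bij by (simp add: bij_is_inj inv_f_f)
  have "connected_component (- (f ` A)) (f p) (f q) \<longleftrightarrow> connected_component (- A) p q" for A
  proof
    assume "connected_component (- (f ` A)) (f p) (f q)"
    from connected_component_image_compl[OF cg ig this]
    show "connected_component (- A) p q" by (simp add: gf image_image)
  qed (rule connected_component_image_compl[OF cf bij_is_inj[OF bij]])
  then show ?thesis unfolding same_face_def by simp
qed

text \<open>The source diagram is uniform of a high level \<open>N\<close>, and the target diagram is its image under
  \<open>f\<close>. The isomorphism is \<open>f\<close> itself; faces correspond because \<open>f\<close>, being affine on each interval,
  maps midpoints of edges to midpoints.\<close>
lemma basilica_map_imp_T_B:
  assumes "basilica_map f"
  shows "f \<in> T_B"
proof -
  obtain F B where pres: "preserves_basilica_rel f" and F: "monotone_lift F f"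
    and B: "finite B" "B \<subseteq> \<Union>basilica_lamination"
    and aff: "\<And>a b. a < b \<Longrightarrow> (\<And>x. a < x \<Longrightarrow> x < b \<Longrightarrow> circ x \<notin> B) \<Longrightarrow> affine_between F a b"
    using assms unfolding basilica_map_def by metis
  note bij = monotone_lift_bij[OF F]
  let ?g = "inv_into UNIV f"
  let ?G = "inv_into UNIV F"
  have lam: "f ` A \<in> basilica_lamination \<longleftrightarrow> A \<in> basilica_lamination" for A
    by (rule preserves_image_lamination[OF bij pres])
  have fg: "f ` (?g ` A) = A" for A
    using bij by (simp add: bij_is_surj image_f_inv_f)
  obtain S where S: "S \<subseteq> basilica_lamination" "finite S" "B \<subseteq> \<Union>S"
    by (rule finite_subset_Union[OF B])
  \<comment> \<open>The arcs that \<open>f\<close> maps to the initial arcs.\<close>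
  define P where "P = (`) ?g ` arcs_upto 1"
  have P: "P \<subseteq> basilica_lamination"
  proof
    fix A
    assume "A \<in> P"
    then have "f ` A \<in> arcs_upto 1" unfolding P_def using fg by auto
    then show "A \<in> basilica_lamination" using arcs_upto_subset lam by blast
  qed
  have "finite (S \<union> P)" using S(2) finite_arcs_upto unfolding P_def by simp
  moreover have "S \<union> P \<subseteq> basilica_lamination" using S(1) P by simp
  ultimately obtain M where M: "S \<union> P \<subseteq> arcs_upto M"
    by (rule finite_lamination_subset_arcs_upto)
  define N where "N = max 1 M"
  define D where "D = arcs_upto N"
  define R where "R = (`) f ` D"
  have MD: "S \<union> P \<subseteq> D" using M arcs_upto_mono[of M N] unfolding D_def N_def by auto
  have BD: "B \<subseteq> \<Union>D" using S(3) MD by blast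
  have Dstd: "standard_interval a b" if "circle_interval D a b" for a b
    using circle_interval_arcs_upto_standard[of N a b] that unfolding D_def N_def by simp
  have D1: "arcs_upto 1 \<subseteq> D" unfolding D_def N_def by (rule arcs_upto_mono) simp
  have Dlam: "D \<subseteq> basilica_lamination" unfolding D_def by (rule arcs_upto_subset)
  have "finite D" unfolding D_def by (rule finite_arcs_upto)
  then have D: "arc_diagram D" using D1 Dlam Dstd by (rule arc_diagramI)
  have UR: "\<Union>R = f ` \<Union>D" unfolding R_def by blast
  have mem: "circ (F x) \<in> \<Union>R \<longleftrightarrow> circ x \<in> \<Union>D" for x
    unfolding UR monotone_liftD(4)[OF F, symmetric] using bij_is_inj[OF bij] by (simp add: inj_image_mem_iff)
  have int: "circle_interval R (F a) (F b) \<longleftrightarrow> circle_interval D a b" for a b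
  proof -
    have "(\<forall>y. F a < y \<and> y < F b \<longrightarrow> circ y \<notin> \<Union>R) \<longleftrightarrow>
        (\<forall>x. F a < F x \<and> F x < F b \<longrightarrow> circ (F x) \<notin> \<Union>R)"
      using monotone_lift_inv(3)[OF F] by metis
    then show ?thesis unfolding circle_interval_def mem monotone_lift_less[OF F] by simp
  qed
  have intE: "\<exists>a b. c = F a \<and> d = F b \<and> circle_interval D a b" if "circle_interval R c d" for c d
    using that int[of "?G c" "?G d"] monotone_lift_inv(3)[OF F] by metis
  have affD: "affine_between F a b" if "circle_interval D a b" for a b
    using that BD unfolding circle_interval_def by (intro aff) auto
  have Rstd: "standard_interval (F a) (F b)" if ab: "circle_interval D a b" for a b
  proof -
    obtain c m where cm: "primary_arc a b = basilica_arc c (Suc m)"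
      using Dstd[OF ab] primary_arc_standard(3) unfolding standard_interval_def by metis
    note len = standard_interval_length[OF Dstd[OF ab]]
    define p where "p = a + (b - a) / 4"
    have p: "a < p" "p < b" unfolding p_def using len by (simp_all add: field_simps)
    have img: "f ` primary_arc a b = primary_arc (F a) (F b)"
    proof -
      have "F (a + t * (b - a)) = F a + t * (F b - F a)" if "t \<in> {0..1}" for t
        using affD[OF ab] that unfolding affine_between_def by blast
      from this[of "1/4"] this[of "3/4"]
      have "F (a + (b - a) / 4) = F a + (F b - F a) / 4" "F (b - (b - a) / 4) = F b - (F b - F a) / 4"
        by (simp_all add: field_simps)
      then show ?thesis unfolding primary_arc_def by (simp add: monotone_liftD(4)[OF F])
    qed
    show ?thesis
    proof (rule arc_ratio_imp_standard)
      show "F a < F b" unfolding monotone_lift_less[OF F] by (rule len)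
      have "F b < F (a + 1)" unfolding monotone_lift_less[OF F] using len by simp
      then show "F b < F a + 1" unfolding monotone_liftD(3)[OF F] .
      have "primary_arc a b \<in> basilica_lamination" unfolding cm basilica_lamination_eq by blast
      then show "primary_arc (F a) (F b) \<in> basilica_lamination" unfolding img[symmetric] lam .
      \<comment> \<open>Otherwise the primary arc of \<open>[a, b]\<close> would be in \<open>P\<close>, hence in \<open>D\<close>, and \<open>[a, b]\<close> would have vertices inside.\<close>
      show "primary_arc (F a) (F b) \<notin> arcs_upto 1"
      proof
        assume "primary_arc (F a) (F b) \<in> arcs_upto 1"
        then have "?g ` (f ` primary_arc a b) \<in> P" unfolding img P_def by (rule imageI)
        then have "primary_arc a b \<in> D" using bij MD by (auto simp: bij_is_inj image_inv_f_f)
        then have "circ p \<in> \<Union>D" unfolding primary_arc_def p_def by blast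
        then show False using ab p unfolding circle_interval_def by blast
      qed
    qed
  qed
  have R: "arc_diagram R"
  proof (rule arc_diagramI)
    show "finite R" unfolding R_def using \<open>finite D\<close> by simp
    show "arcs_upto 1 \<subseteq> R"
    proof
      fix A :: "circle set"
      assume "A \<in> arcs_upto 1"
      then have "?g ` A \<in> D" using MD unfolding P_def by blast
      then have "f ` (?g ` A) \<in> R" unfolding R_def by (rule imageI)
      then show "A \<in> R" unfolding fg .
    qed
    show "R \<subseteq> basilica_lamination" unfolding R_def using Dlam lam by blast
    show "standard_interval c d" if "circle_interval R c d" for c d
      using intE[OF that] Rstd by blast
  qed
  have edge: "circle_edges R = map_prod f f ` circle_edges D"
  proof -
    have "circle_edges R = {(circ (F a), circ (F b)) | a b. circle_interval D a b}"
      unfolding circle_edges_def using intE int by blast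
    also have "\<dots> = map_prod f f ` circle_edges D"
      unfolding circle_edges_def monotone_liftD(4)[OF F, symmetric] by (force simp: image_iff)
    finally show ?thesis .
  qed
  have mid: "circ ((F a + F b) / 2) = f (circ ((a + b) / 2))" if "circle_interval D a b" for a b
  proof -
    have "F (a + 1/2 * (b - a)) = F a + 1/2 * (F b - F a)"
      using affD[OF that] unfolding affine_between_def by (rule bspec) simp
    then have eq: "F ((a + b) / 2) = (F a + F b) / 2" by (simp add: field_simps)
    show ?thesis unfolding monotone_liftD(4)[OF F] eq ..
  qed
  define face where "face D' a b = {(circ c, circ d) | c d. circle_interval D' c d \<and>
          same_face D' (circ ((a + b) / 2)) (circ ((c + d) / 2))}" for D' a b
  have face: "face R (F a) (F b) = map_prod f f ` face D a b" if ab: "circle_interval D a b" for a b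
  proof -
    have sf: "same_face R (circ ((F a + F b) / 2)) (circ ((F c + F d) / 2)) \<longleftrightarrow>
        same_face D (circ ((a + b) / 2)) (circ ((c + d) / 2))" if "circle_interval D c d" for c d
      unfolding mid[OF ab] mid[OF that] R_def by (rule same_face_image[OF F])
    have "face R (F a) (F b) = {(circ (F c), circ (F d)) | c d. circle_interval D c d \<and>
        same_face D (circ ((a + b) / 2)) (circ ((c + d) / 2))}" (is "_ = ?X")
    proof (intro equalityI subsetI)
      fix e assume "e \<in> face R (F a) (F b)"
      then obtain c d where cd: "e = (circ c, circ d)" "circle_interval R c d"
        "same_face R (circ ((F a + F b) / 2)) (circ ((c + d) / 2))"
        unfolding face_def by blast
      obtain c' d' where cd': "c = F c'" "d = F d'" "circle_interval D c' d'" using intE[OF cd(2)] by blast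
      have "same_face D (circ ((a + b) / 2)) (circ ((c' + d') / 2))"
        using cd(3) sf[OF cd'(3)] unfolding cd' by simp
      then show "e \<in> ?X" unfolding cd(1) cd'(1,2) using cd'(3) by blast
    next
      fix e assume "e \<in> ?X"
      then obtain c d where cd: "e = (circ (F c), circ (F d))" "circle_interval D c d"
        "same_face D (circ ((a + b) / 2)) (circ ((c + d) / 2))" by blast
      have "same_face R (circ ((F a + F b) / 2)) (circ ((F c + F d) / 2))"
        using cd(3) sf[OF cd(2)] by simp
      moreover have "circle_interval R (F c) (F d)" using cd(2) by (simp add: int)
      ultimately show "e \<in> face R (F a) (F b)" unfolding face_def cd(1) by blast
    qed
    also have "\<dots> = map_prod f f ` face D a b"
      unfolding face_def monotone_liftD(4)[OF F, symmetric] by (force simp: image_iff)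
    finally show ?thesis .
  qed
  have faces_eq: "faces D' = {face D' a b | a b. circle_interval D' a b}" for D'
    unfolding faces_def face_def ..
  have faces: "faces R = (\<lambda>E. map_prod f f ` E) ` faces D"
  proof -
    have "faces R = {face R (F a) (F b) | a b. circle_interval D a b}"
      unfolding faces_eq using intE int by blast
    also have "\<dots> = {map_prod f f ` face D a b | a b. circle_interval D a b}"
      using face by (metis (no_types, lifting))
    also have "\<dots> = (\<lambda>E. map_prod f f ` E) ` faces D" unfolding faces_eq by blast
    finally show ?thesis .
  qed
  have "bij_betw f (\<Union>D) (\<Union>R)"
    unfolding UR using bij by (meson bij_betw_subset bij_betw_imageI bij_is_inj inj_on_subset subset_UNIV)
  then have "diagram_isomorphism f D R"
    unfolding diagram_isomorphism_def edge faces by (simp add: R_def)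
  moreover have "induced_by f f D R"
    unfolding induced_by_def
  proof (intro allI impI ballI, elim conjE)
    fix a b c d t :: real
    assume ab: "circle_interval D a b" and cd: "circle_interval R c d"
      and c: "f (circ a) = circ c" and t: "t \<in> {0..1}"
    have "circ c = circ (F a)" using c monotone_liftD(4)[OF F] by metis
    then obtain k where k: "c = F a + of_int k" by (rule circ_eqE)
    have Rab: "circle_interval R (F a + of_int k) (F b + of_int k)"
      using ab int by (intro circle_interval_translate) simp
    then have "d = F b + of_int k"
      using circle_intervals_overlap(2)[OF cd Rab] cd unfolding k circle_interval_def by simp
    with k have "c + t * (d - c) = F a + t * (F b - F a) + of_int k" by simp
    also have "F a + t * (F b - F a) = F (a + t * (b - a))"
      using affD[OF ab] t unfolding affine_between_def by simp
    finally show "f (circ (a + t * (b - a))) = circ (c + t * (d - c))"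
      by (simp add: monotone_liftD(4)[OF F])
  qed
  ultimately show ?thesis unfolding T_B_def using D R by blast
qed

lemma T_B_iff_basilica_map: "f \<in> T_B \<longleftrightarrow> basilica_map f"
  using T_B_imp_basilica_map basilica_map_imp_T_B by blast

lemma preserves_mem_lamination_iff:
  assumes "bij f" "preserves_basilica_rel f"
  shows "f p \<in> \<Union>basilica_lamination \<longleftrightarrow> p \<in> \<Union>basilica_lamination"
proof -
  have "(\<exists>q. q \<noteq> f p \<and> basilica_rel (f p) q) \<longleftrightarrow> (\<exists>q. f q \<noteq> f p \<and> basilica_rel (f p) (f q))"
    using bij_is_surj[OF assms(1)] by (metis surjD)
  also have "\<dots> \<longleftrightarrow> (\<exists>q. q \<noteq> p \<and> basilica_rel p q)"
    using assms(2) bij_is_inj[OF assms(1)] unfolding preserves_basilica_rel_def by (metis injD)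
  finally show ?thesis unfolding mem_lamination_iff .
qed

section \<open>The group of rearrangements\<close>

lemma basilica_map_id: "basilica_map id"
proof -
  have "affine_between id a b" for a b unfolding affine_between_def by simp
  then show ?thesis
    unfolding basilica_map_def preserves_basilica_rel_def using monotone_lift_id
    by (intro conjI exI[of _ id] exI[of _ "{}"] allI impI) simp_all
qed

lemma basilica_map_comp:
  assumes "basilica_map f" "basilica_map g"
  shows "basilica_map (f \<circ> g)"
proof -
  obtain F B where pf: "preserves_basilica_rel f" and F: "monotone_lift F f"
    and B: "finite B" "B \<subseteq> \<Union>basilica_lamination"
    and affF: "\<And>a b. a < b \<Longrightarrow> (\<And>x. a < x \<Longrightarrow> x < b \<Longrightarrow> circ x \<notin> B) \<Longrightarrow> affine_between F a b"
    using assms(1) unfolding basilica_map_def by metis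
  obtain G C where pg: "preserves_basilica_rel g" and G: "monotone_lift G g"
    and C: "finite C" "C \<subseteq> \<Union>basilica_lamination"
    and affG: "\<And>a b. a < b \<Longrightarrow> (\<And>x. a < x \<Longrightarrow> x < b \<Longrightarrow> circ x \<notin> C) \<Longrightarrow> affine_between G a b"
    using assms(2) unfolding basilica_map_def by metis
  note bg = monotone_lift_bij[OF G]
  have "preserves_basilica_rel (f \<circ> g)"
    using pf pg unfolding preserves_basilica_rel_def by simp
  moreover have "finite (C \<union> g -` B)"
    using B(1) C(1) bij_is_inj[OF bg] by (simp add: finite_vimageI)
  moreover have "C \<union> g -` B \<subseteq> \<Union>basilica_lamination"
  proof (intro Un_least subsetI)
    show "p \<in> \<Union>basilica_lamination" if "p \<in> C" for p using that C(2) by (rule subsetD[rotated])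
    fix p
    assume "p \<in> g -` B"
    then have "g p \<in> \<Union>basilica_lamination" using B(2) by (intro subsetD[OF B(2)]) simp
    then show "p \<in> \<Union>basilica_lamination" unfolding preserves_mem_lamination_iff[OF bg pg] .
  qed
  moreover have "affine_between (F \<circ> G) a b"
    if ab: "a < b" "\<forall>x. a < x \<and> x < b \<longrightarrow> circ x \<notin> C \<union> g -` B" for a b
  proof (rule affine_between_comp)
    show "affine_between G a b" using ab by (intro affG) auto
    show "affine_between F (G a) (G b)"
    proof (rule affF)
      show "G a < G b" using ab(1) monotone_lift_less[OF G] by simp
      fix y assume y: "G a < y" "y < G b"
      obtain x where x: "y = G x" using monotone_liftD(2)[OF G] by (metis surjD)
      then have "a < x" "x < b" using y monotone_lift_less[OF G] by simp_all
      then have "g (circ x) \<notin> B" using ab(2) by simp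
      then show "circ y \<notin> B" unfolding x monotone_liftD(4)[OF G] .
    qed
  qed
  ultimately show ?thesis
    unfolding basilica_map_def using monotone_lift_comp[OF F G]
    by (intro conjI exI[of _ "F \<circ> G"] exI[of _ "C \<union> g -` B"] allI impI) (assumption | elim conjE)+
qed

lemma basilica_map_inv:
  assumes "basilica_map f"
  shows "basilica_map (inv_into UNIV f)" "inv_into UNIV f \<circ> f = id"
proof -
  obtain F B where pf: "preserves_basilica_rel f" and F: "monotone_lift F f"
    and B: "finite B" "B \<subseteq> \<Union>basilica_lamination"
    and affF: "\<And>a b. a < b \<Longrightarrow> (\<And>x. a < x \<Longrightarrow> x < b \<Longrightarrow> circ x \<notin> B) \<Longrightarrow> affine_between F a b"
    using assms unfolding basilica_map_def by metis
  let ?g = "inv_into UNIV f"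
  let ?G = "inv_into UNIV F"
  note bf = monotone_lift_bij[OF F] and G = monotone_lift_inv[OF F]
  have fg: "f (?g p) = p" for p using bf by (simp add: bij_is_surj surj_f_inv_f)
  show "?g \<circ> f = id" using bf by (simp add: bij_is_inj)
  have "preserves_basilica_rel ?g"
    using pf fg unfolding preserves_basilica_rel_def by metis
  moreover have "finite (f ` B)" using B(1) by simp
  moreover have "f ` B \<subseteq> \<Union>basilica_lamination"
  proof (rule image_subsetI)
    fix p
    assume "p \<in> B"
    then show "f p \<in> \<Union>basilica_lamination"
      unfolding preserves_mem_lamination_iff[OF bf pf] using B(2) by (rule subsetD[rotated])
  qed
  moreover have "affine_between ?G a b"
    if ab: "a < b" "\<forall>x. a < x \<and> x < b \<longrightarrow> circ x \<notin> f ` B" for a b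
  proof -
    have "affine_between F (?G a) (?G b)"
    proof (rule affF)
      show "?G a < ?G b" using ab(1) monotone_lift_less[OF G(1)] by simp
      fix x assume "?G a < x" "x < ?G b"
      then have "a < F x" "F x < b"
        using monotone_lift_less[OF F, of "?G a" x] monotone_lift_less[OF F, of x "?G b"] G(3) by simp_all
      then have "circ (F x) \<notin> f ` B" using ab(2) by simp
      then show "circ x \<notin> B" using monotone_liftD(4)[OF F, of x] by (metis imageI)
    qed
    from affine_between_inv[OF F this] show ?thesis unfolding G(3) .
  qed
  ultimately show "basilica_map ?g"
    unfolding basilica_map_def using G(1)
    by (intro conjI exI[of _ ?G] exI[of _ "f ` B"] allI impI) (assumption | elim conjE)+
qed

lemma T_B_group: "group \<lparr>carrier = T_B, monoid.mult = (\<circ>), one = id\<rparr>"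
proof (rule groupI)
  fix f
  assume "f \<in> carrier \<lparr>carrier = T_B, monoid.mult = (\<circ>), one = id\<rparr>"
  then have f: "basilica_map f" by (simp add: T_B_iff_basilica_map)
  show "\<exists>g\<in>carrier \<lparr>carrier = T_B, monoid.mult = (\<circ>), one = id\<rparr>.
      g \<otimes>\<^bsub>\<lparr>carrier = T_B, monoid.mult = (\<circ>), one = id\<rparr>\<^esub> f = \<one>\<^bsub>\<lparr>carrier = T_B, monoid.mult = (\<circ>), one = id\<rparr>\<^esub>"
    using basilica_map_inv[OF f] by (auto simp: T_B_iff_basilica_map)
qed (auto simp: T_B_iff_basilica_map basilica_map_comp basilica_map_id o_assoc)

section \<open>Piecewise-linear homeomorphisms and breakpoints\<close>

lemma lifts_differ_by_int:
  assumes F: "is_lift F f" and G: "is_lift G f"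
  obtains k :: int where "\<And>x. G x = F x + of_int k"
proof -
  have Z: "\<exists>k::int. G x - F x = of_int k" for x
  proof -
    have "circ (G x) = circ (F x)" using F G unfolding is_lift_def by metis
    then obtain k :: int where "G x = F x + of_int k" by (rule circ_eqE)
    then show ?thesis by (intro exI[of _ k]) simp
  qed
  have "(\<lambda>x. G x - F x) constant_on UNIV"
  proof (rule continuous_discrete_range_constant)
    show "continuous_on UNIV (\<lambda>x. G x - F x)"
      using F G unfolding is_lift_def by (intro continuous_on_diff) blast+
    fix x :: real
    have "1 \<le> norm (G y - F y - (G x - F x))" if "G y - F y \<noteq> G x - F x" for y
    proof -
      obtain k l :: int where kl: "G x - F x = of_int k" "G y - F y = of_int l" using Z by metis
      then have "l \<noteq> k" using that by auto
      then have "1 \<le> \<bar>l - k\<bar>" by simp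
      then have "real_of_int 1 \<le> of_int \<bar>l - k\<bar>" unfolding of_int_le_iff .
      then show ?thesis unfolding kl by simp
    qed
    then show "\<exists>e>0. \<forall>y. y \<in> UNIV \<and> G y - F y \<noteq> G x - F x \<longrightarrow> e \<le> norm (G y - F y - (G x - F x))"
      by (intro exI[of _ 1]) simp
  qed simp
  then obtain c where c: "\<And>x. G x - F x = c" unfolding constant_on_def by auto
  obtain k :: int where k: "G 0 - F 0 = of_int k" using Z by blast
  have "G x = F x + of_int k" for x using c[of x] c[of 0] k by simp
  then show ?thesis by (rule that)
qed

text \<open>The lift advances by a positive integer over one turn. If it advanced by \<open>2\<close> or more, it
  would take the value \<open>F x + 1\<close> strictly inside the turn, against injectivity of \<open>f\<close>.\<close>
lemma strictly_monotone_lift: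
  assumes lift: "is_lift F f" and mono: "strict_mono F" and inj: "inj f"
  shows "monotone_lift F f"
proof -
  have cont: "continuous_on A F" for A
    using lift unfolding is_lift_def by (metis continuous_on_subset subset_UNIV)
  have fc: "f (circ x) = circ (F x)" for x using lift unfolding is_lift_def by blast
  have one: "F (x + 1) = F x + 1" for x
  proof -
    have "circ (F (x + 1)) = circ (F x)" using fc[of "x + 1"] fc[of x] by simp
    then obtain k :: int where k: "F (x + 1) = F x + of_int k" by (rule circ_eqE)
    have "F x < F (x + 1)" using mono by (simp add: strict_mono_less)
    then have "0 < k" using k by simp
    moreover have "\<not> 2 \<le> k"
    proof
      assume "2 \<le> k"
      then have k2: "2 \<le> real_of_int k" by simp
      then have "\<exists>y. x \<le> y \<and> y \<le> x + 1 \<and> F y = F x + 1"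
        using k by (intro IVT' cont) simp_all
      then obtain y where y: "x \<le> y" "y \<le> x + 1" "F y = F x + 1" by blast
      then have "f (circ y) = f (circ x)" unfolding fc by simp
      then have "circ y = circ x" using inj by (simp add: inj_eq)
      then obtain j :: int where j: "y = x + of_int j" by (rule circ_eqE)
      then have "0 \<le> j" "j \<le> 1" using y by simp_all
      then consider "j = 0" | "j = 1" by linarith
      then show False
      proof cases
        case 1
        then show False using y(3) j by simp
      next
        case 2
        then show False using y(3) j k k2 by simp
      qed
    qed
    ultimately have "k = 1" by simp
    then show ?thesis using k by simp
  qed
  have shift: "F (of_int k) = F 0 + of_int k" for k :: int
    using shift_multiple[of "\<lambda>i. F (of_int i)" 1 0 k] one by simp
  have "\<exists>x. F x = y" for y
  proof -
    define k where "k = \<lfloor>y - F 0\<rfloor>"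
    have "F (of_int k) \<le> y" "y \<le> F (of_int (k + 1))"
      unfolding shift k_def by linarith+
    then have "\<exists>x. of_int k \<le> x \<and> x \<le> of_int (k + 1) \<and> F x = y"
      by (intro IVT' cont) simp_all
    then show ?thesis by blast
  qed
  then have "surj F" by (metis surj_def)
  then show ?thesis unfolding monotone_lift_def using mono one fc by blast
qed

lemma consecutive_bracket:
  fixes t :: "nat \<Rightarrow> real"
  shows "t 0 \<le> u \<Longrightarrow> u < t n \<Longrightarrow> \<exists>i<n. t i \<le> u \<and> u < t (Suc i)"
    and "t 0 < u \<Longrightarrow> u \<le> t n \<Longrightarrow> \<exists>i<n. t i < u \<and> u \<le> t (Suc i)"
proof (induction n)
  case (Suc n)
  {
    case 1
    show ?case
    proof (cases "u < t n")
      case True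
      then show ?thesis using Suc.IH(1)[OF 1(1)] less_SucI by blast
    next
      case False
      then show ?thesis using 1(2) by (intro exI[of _ n]) simp
    qed
  next
    case 2
    show ?case
    proof (cases "u \<le> t n")
      case True
      then show ?thesis using Suc.IH(2)[OF 2(1)] less_SucI by blast
    next
      case False
      then show ?thesis using 2(2) by (intro exI[of _ n]) simp
    qed
  }
qed simp_all

text \<open>The partition covers \<open>[0, 1]\<close>, so a point is first translated into \<open>[0, 1)\<close> for the right slope
  and into \<open>(0, 1]\<close> for the left one; the two translations differ at the integers.\<close>
lemma piecewise_linear_one_sided_slopes:
  fixes t :: "nat \<Rightarrow> real"
  assumes F: "monotone_lift F f" and t: "t 0 = 0" "t n = 1"
    and lin: "\<And>i. i < n \<Longrightarrow> \<exists>m c. \<forall>y\<in>{t i..t (Suc i)}. F y = m * y + c"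
  obtains \<epsilon> l r where "0 < \<epsilon>"
    "\<And>y. x - \<epsilon> \<le> y \<Longrightarrow> y \<le> x \<Longrightarrow> F y = F x + l * (y - x)"
    "\<And>y. x \<le> y \<Longrightarrow> y \<le> x + \<epsilon> \<Longrightarrow> F y = F x + r * (y - x)"
    "l \<noteq> r \<Longrightarrow> circ x \<in> circ ` t ` {..n}"
proof -
  have piece: "\<exists>m. \<forall>y. t i \<le> y - of_int k \<and> y - of_int k \<le> t (Suc i) \<longrightarrow> F y = F x + m * (y - x)"
    if i: "i < n" and x: "t i \<le> x - of_int k" "x - of_int k \<le> t (Suc i)" for i k
  proof -
    obtain m c where mc: "\<And>y. y \<in> {t i..t (Suc i)} \<Longrightarrow> F y = m * y + c" using lin[OF i] by blast
    have on: "F y = m * (y - of_int k) + c + of_int k"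
      if "t i \<le> y - of_int k" "y - of_int k \<le> t (Suc i)" for y
      using mc[of "y - of_int k"] monotone_lift_add_int[OF F, of "y - of_int k" k] that by simp
    have "F y = F x + m * (y - x)" if y: "t i \<le> y - of_int k" "y - of_int k \<le> t (Suc i)" for y
      unfolding on[OF y] on[OF x] by (simp add: algebra_simps)
    then show ?thesis by (intro exI[of _ m] allI impI) (elim conjE)
  qed
  have "\<exists>i<n. t i \<le> x - of_int \<lfloor>x\<rfloor> \<and> x - of_int \<lfloor>x\<rfloor> < t (Suc i)"
    by (rule consecutive_bracket(1)) (use t in linarith)+
  then obtain i k where i: "i < n" "t i \<le> x - of_int k" "x - of_int k < t (Suc i)" by blast
  obtain r where r: "\<And>y. t i \<le> y - of_int k \<Longrightarrow> y - of_int k \<le> t (Suc i) \<Longrightarrow> F y = F x + r * (y - x)"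
    using piece[OF i(1,2) less_imp_le[OF i(3)]] by (elim exE) blast
  show ?thesis
  proof (cases "t i = x - of_int k")
    case False
    with i have lt: "t i < x - of_int k" by simp
    define \<epsilon> where "\<epsilon> = min (x - of_int k - t i) (t (Suc i) - (x - of_int k))"
    have \<epsilon>: "0 < \<epsilon>" "\<epsilon> \<le> x - of_int k - t i" "\<epsilon> \<le> t (Suc i) - (x - of_int k)"
      unfolding \<epsilon>_def using lt i(3) by simp_all
    show ?thesis
    proof (rule that[of \<epsilon> r r])
      show "F y = F x + r * (y - x)" if "x - \<epsilon> \<le> y" "y \<le> x" for y
        by (rule r) (use that \<epsilon> in linarith)+
      show "F y = F x + r * (y - x)" if "x \<le> y" "y \<le> x + \<epsilon>" for y
        by (rule r) (use that \<epsilon> in linarith)+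
    qed (use \<epsilon> in simp_all)
  next
    case True
    then have "circ x = circ (t i + of_int k)" by simp
    then have mem: "circ x \<in> circ ` t ` {..n}" using i(1) by simp
    have "\<exists>j<n. t j < x - of_int (\<lceil>x\<rceil> - 1) \<and> x - of_int (\<lceil>x\<rceil> - 1) \<le> t (Suc j)"
      by (rule consecutive_bracket(2)) (use t ceiling_correct[of x] in simp_all)
    then obtain j h where j: "j < n" "t j < x - of_int h" "x - of_int h \<le> t (Suc j)" by blast
    obtain l where l: "\<And>y. t j \<le> y - of_int h \<Longrightarrow> y - of_int h \<le> t (Suc j) \<Longrightarrow> F y = F x + l * (y - x)"
      using piece[OF j(1) less_imp_le[OF j(2)] j(3)] by (elim exE) blast
    define \<epsilon> where "\<epsilon> = min (x - of_int h - t j) (t (Suc i) - (x - of_int k))"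
    have \<epsilon>: "0 < \<epsilon>" "\<epsilon> \<le> x - of_int h - t j" "\<epsilon> \<le> t (Suc i) - (x - of_int k)"
      unfolding \<epsilon>_def using i(3) j(2) by simp_all
    show ?thesis
    proof (rule that[of \<epsilon> l r])
      show "F y = F x + l * (y - x)" if "x - \<epsilon> \<le> y" "y \<le> x" for y
        by (rule l) (use that \<epsilon> j in linarith)+
      show "F y = F x + r * (y - x)" if "x \<le> y" "y \<le> x + \<epsilon>" for y
        by (rule r) (use that \<epsilon> i in linarith)+
    qed (use \<epsilon>(1) mem in simp_all)
  qed
qed

lemma affine_has_derivative:
  fixes c m x z :: real
  shows "((\<lambda>y. c + m * (y - x)) has_real_derivative m) (at z within S)"
proof -
  have "((\<lambda>y. c + m * (y - x)) has_real_derivative 0 + m * (1 - 0)) (at z within S)"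
    by (intro DERIV_add DERIV_const DERIV_cmult DERIV_diff DERIV_ident)
  then show ?thesis by simp
qed

lemma left_slope_has_derivative:
  fixes F :: "real \<Rightarrow> real"
  assumes "0 < \<epsilon>" "\<And>y. x - \<epsilon> \<le> y \<Longrightarrow> y \<le> x \<Longrightarrow> F y = F x + l * (y - x)"
  shows "(F has_real_derivative l) (at_left x)"
proof -
  have "((\<lambda>y. F x + l * (y - x)) has_real_derivative l) (at x within {..x})"
    by (rule affine_has_derivative)
  then have "(F has_real_derivative l) (at x within {..x})"
  proof (rule has_field_derivative_transform_within[OF _ assms(1)])
    show "F x + l * (y - x) = F y" if "y \<in> {..x}" "dist y x < \<epsilon>" for y
      by (rule assms(2)[symmetric]) (use that in \<open>auto simp: dist_real_def\<close>)
  qed simp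
  then show ?thesis by (rule DERIV_subset) auto
qed

lemma right_slope_has_derivative:
  fixes F :: "real \<Rightarrow> real"
  assumes "0 < \<epsilon>" "\<And>y. x \<le> y \<Longrightarrow> y \<le> x + \<epsilon> \<Longrightarrow> F y = F x + r * (y - x)"
  shows "(F has_real_derivative r) (at_right x)"
proof -
  have "((\<lambda>y. F x + r * (y - x)) has_real_derivative r) (at x within {x..})"
    by (rule affine_has_derivative)
  then have "(F has_real_derivative r) (at x within {x..})"
  proof (rule has_field_derivative_transform_within[OF _ assms(1)])
    show "F x + r * (y - x) = F y" if "y \<in> {x..}" "dist y x < \<epsilon>" for y
      by (rule assms(2)[symmetric]) (use that in \<open>auto simp: dist_real_def\<close>)
  qed simp
  then show ?thesis by (rule DERIV_subset) auto
qed

text \<open>The derivative is locally constant on a connected set, hence constant.\<close>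
lemma locally_affine_imp_affine_between:
  assumes ab: "a < b" and cont: "continuous_on {a..b} F"
    and loc: "\<And>x. a < x \<Longrightarrow> x < b \<Longrightarrow> \<exists>\<epsilon>>0. \<exists>m. \<forall>y\<in>{x - \<epsilon><..<x + \<epsilon>}. F y = F x + m * (y - x)"
  shows "affine_between F a b"
proof -
  have nbhd: "\<exists>\<epsilon>>0. \<exists>m. \<forall>y\<in>{x - \<epsilon><..<x + \<epsilon>}. (F has_real_derivative m) (at y)"
    if x: "a < x" "x < b" for x
  proof -
    obtain \<epsilon> m where \<epsilon>: "\<epsilon> > 0" and m: "\<And>y. y \<in> {x - \<epsilon><..<x + \<epsilon>} \<Longrightarrow> F y = F x + m * (y - x)"
      using loc[OF x] by metis
    have "(F has_real_derivative m) (at y)" if "y \<in> {x - \<epsilon><..<x + \<epsilon>}" for y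
    proof -
      have "((\<lambda>z. F x + m * (z - x)) has_real_derivative m) (at y)"
        by (rule affine_has_derivative)
      then show ?thesis
        by (rule has_field_derivative_transform_within_open[OF _ open_greaterThanLessThan that])
          (rule m[symmetric])
    qed
    then show ?thesis using \<epsilon> by blast
  qed
  have der: "(F has_real_derivative deriv F x) (at x)" if x: "a < x" "x < b" for x
  proof -
    obtain \<epsilon> m where "\<epsilon> > 0" "\<forall>y\<in>{x - \<epsilon><..<x + \<epsilon>}. (F has_real_derivative m) (at y)"
      using nbhd[OF x] by metis
    then have "(F has_real_derivative m) (at x)" by simp
    then show ?thesis by (simp add: DERIV_imp_deriv)
  qed
  have const: "deriv F x = deriv F y" if "x \<in> {a<..<b}" "y \<in> {a<..<b}" for x y
  proof (rule connected_local_const[OF connected_Ioo that], intro ballI)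
    fix u
    assume u: "u \<in> {a<..<b}"
    then obtain \<epsilon> m where \<epsilon>: "\<epsilon> > 0" "\<And>y. y \<in> {u - \<epsilon><..<u + \<epsilon>} \<Longrightarrow> (F has_real_derivative m) (at y)"
      using nbhd[of u] by (metis greaterThanLessThan_iff)
    have "deriv F u = deriv F y" if "dist y u < \<epsilon>" for y
    proof -
      have "deriv F u = m" "deriv F y = m"
        using \<epsilon> that by (auto intro!: DERIV_imp_deriv \<epsilon>(2) simp: dist_real_def)
      then show ?thesis by simp
    qed
    then show "\<forall>\<^sub>F y in at u within {a<..<b}. deriv F u = deriv F y"
      unfolding eventually_at using \<epsilon>(1) by blast
  qed
  define m where "m = deriv F ((a + b) / 2)"
  have "F x = F a + m * (x - a)" if x: "x \<in> {a..b}" for x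
  proof (cases "a < x")
    case True
    have "\<exists>l z. a < z \<and> z < x \<and> DERIV F z :> l \<and> F x - F a = (x - a) * l"
    proof (rule MVT[OF True])
      show "continuous_on {a..x} F" using cont by (rule continuous_on_subset) (use x in auto)
      show "F differentiable at y" if "a < y" "y < x" for y
        using der[of y] that x by (auto simp: real_differentiable_def)
    qed
    then obtain l z where z: "a < z" "z < x" "DERIV F z :> l" "F x - F a = (x - a) * l" by blast
    have "l = deriv F z" using z(3) by (simp add: DERIV_imp_deriv)
    also have "\<dots> = m" unfolding m_def by (rule const) (use z x ab in auto)
    finally show ?thesis using z(4) by (simp add: algebra_simps)
  next
    case False
    then have "x = a" using x by simp
    then show ?thesis by simp
  qed
  then show ?thesis unfolding affine_between_iff_slope[OF less_imp_le[OF ab]] by blast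
qed

text \<open>The partition points that are breakpoints serve as the set \<open>B\<close>: at the other partition points
  the two one-sided slopes agree and the neighbouring pieces fit together.\<close>
lemma basilica_mapI:
  assumes pl: "pl_homeomorphism f" and ori: "orientation_preserving f"
    and pres: "preserves_basilica_rel f"
    and break: "\<And>p. breakpoint f p \<Longrightarrow> \<exists>A\<in>basilica_lamination. p \<in> A"
  shows "basilica_map f"
proof -
  have inj: "inj f"
    using pl unfolding pl_homeomorphism_def homeomorphism_def by (metis UNIV_I inj_on_def)
  obtain F where liftF: "is_lift F f" and mono: "strict_mono F"
    using ori unfolding orientation_preserving_def by blast
  have F: "monotone_lift F f" using liftF mono inj by (rule strictly_monotone_lift)
  obtain F' n t where liftF': "is_lift F' f" and t: "t 0 = 0" "t n = 1"
    and lin: "\<And>i. i < n \<Longrightarrow> \<exists>m c. \<forall>x\<in>{t i..t (Suc i)}. F' x = m * x + c"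
    using pl unfolding pl_homeomorphism_def piecewise_linear_def by metis
  obtain k :: int where k: "\<And>x. F' x = F x + of_int k"
    using lifts_differ_by_int[OF liftF liftF'] by metis
  have linF: "\<exists>m c. \<forall>x\<in>{t i..t (Suc i)}. F x = m * x + c" if i: "i < n" for i
  proof -
    obtain m c where mc: "\<And>x. x \<in> {t i..t (Suc i)} \<Longrightarrow> F' x = m * x + c" using lin[OF i] by blast
    have "F x = m * x + (c - of_int k)" if "x \<in> {t i..t (Suc i)}" for x
      using mc[OF that] k[of x] by simp
    then show ?thesis by blast
  qed
  define B where "B = {p \<in> circ ` t ` {..n}. breakpoint f p}"
  have "finite B" unfolding B_def by simp
  moreover have "B \<subseteq> \<Union>basilica_lamination" unfolding B_def using break by blast
  moreover have "affine_between F a b" if ab: "a < b" "\<forall>x. a < x \<and> x < b \<longrightarrow> circ x \<notin> B" for a b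
  proof (rule locally_affine_imp_affine_between[OF ab(1)])
    show "continuous_on {a..b} F"
      using monotone_lift_continuous[OF F] by (rule continuous_on_subset) simp
    fix x
    assume x: "a < x" "x < b"
    obtain \<epsilon> l r where \<epsilon>: "0 < \<epsilon>"
      and l: "\<And>y. x - \<epsilon> \<le> y \<Longrightarrow> y \<le> x \<Longrightarrow> F y = F x + l * (y - x)"
      and r: "\<And>y. x \<le> y \<Longrightarrow> y \<le> x + \<epsilon> \<Longrightarrow> F y = F x + r * (y - x)"
      and mem: "l \<noteq> r \<Longrightarrow> circ x \<in> circ ` t ` {..n}"
      by (rule piecewise_linear_one_sided_slopes[OF F t linF, of x]) (assumption, rule that)
    have "l = r"
    proof (rule ccontr)
      assume lr: "l \<noteq> r"
      have "(F has_real_derivative l) (at_left x)" using \<epsilon> l by (rule left_slope_has_derivative)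
      moreover have "(F has_real_derivative r) (at_right x)" using \<epsilon> r by (rule right_slope_has_derivative)
      ultimately have "breakpoint f (circ x)" unfolding breakpoint_def using lr liftF by blast
      then show False using mem[OF lr] ab(2) x unfolding B_def by blast
    qed
    have "F y = F x + l * (y - x)" if y: "y \<in> {x - \<epsilon><..<x + \<epsilon>}" for y
    proof (cases "y \<le> x")
      case True
      then show ?thesis by (intro l) (use y in simp_all)
    next
      case False
      then show ?thesis unfolding \<open>l = r\<close> by (intro r) (use y in simp_all)
    qed
    then show "\<exists>\<epsilon>>0. \<exists>m. \<forall>y\<in>{x - \<epsilon><..<x + \<epsilon>}. F y = F x + m * (y - x)" using \<epsilon> by blast
  qed
  ultimately show ?thesis
    unfolding basilica_map_def using F pres
    by (intro conjI exI[of _ F] exI[of _ B] allI impI) (assumption | elim conjE)+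
qed

text \<open>Away from the vertices of the diagram the lift is affine near the point, and any other
  lift differs from it by a constant, so the one-sided derivatives agree.\<close>
lemma T_B_breakpoint:
  assumes f: "f \<in> T_B" and p: "breakpoint f p"
  shows "p \<in> \<Union>basilica_lamination"
proof (rule ccontr)
  assume notin: "p \<notin> \<Union>basilica_lamination"
  obtain F D R where D: "arc_diagram D" and F: "monotone_lift F f"
    and aff: "\<And>a b. circle_interval D a b \<Longrightarrow> circle_interval R (F a) (F b) \<and> affine_between F a b"
    using T_B_lift[OF f] by metis
  obtain G x l r where G: "is_lift G f" and x: "circ x = p" and lr: "l \<noteq> r"
    and l: "(G has_real_derivative l) (at_left x)" and r: "(G has_real_derivative r) (at_right x)"
    using p unfolding breakpoint_def by metis
  obtain k :: int where k: "\<And>x. G x = F x + of_int k"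
    using lifts_differ_by_int[OF monotone_lift_is_lift[OF F] G] by metis
  note Dstd = arc_diagram_imp_standard[OF D]
  obtain v :: "int \<Rightarrow> real" where v: "strict_mono v" "range v = {x. circ x \<in> \<Union>D}" "0 < card (\<Union>D)"
    "\<And>i. v (i + int (card (\<Union>D))) = v i + 1"
    by (rule lamination_subset_enumeration[of D]) (use Dstd in simp_all)
  obtain i where i: "v i \<le> x" "x < v (i + 1)"
    by (rule strict_mono_int_locate[of v "card (\<Union>D)", OF v(1,4)])
  have "circ (v i) \<in> \<Union>D" using v(2) by (metis mem_Collect_eq rangeI)
  then have "circ (v i) \<in> \<Union>basilica_lamination" using Dstd by blast
  then have "v i \<noteq> x" using notin x by metis
  with i have lt: "v i < x" by simp
  have "circle_interval D (v i) (v (i + 1))"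
    unfolding circle_interval_enum[OF v(1,2)] by (rule exI[of _ i]) simp
  then have "affine_between F (v i) (v (i + 1))" using aff by blast
  moreover have "v i \<le> v (i + 1)" using i by simp
  ultimately obtain m where m: "\<And>y. y \<in> {v i..v (i + 1)} \<Longrightarrow> F y = F (v i) + m * (y - v i)"
    using affine_between_iff_slope[of "v i" "v (i + 1)" F] by metis
  have "((\<lambda>y. F (v i) + of_int k + m * (y - v i)) has_real_derivative m) (at x)"
    by (rule affine_has_derivative)
  then have G': "(G has_real_derivative m) (at x)"
  proof (rule has_field_derivative_transform_within_open)
    show "x \<in> {v i<..<v (i + 1)}" using lt i by simp
    show "F (v i) + of_int k + m * (y - v i) = G y" if "y \<in> {v i<..<v (i + 1)}" for y
      using m[of y] k[of y] that by simp
  qed simp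
  have "m = l"
    by (rule has_field_derivative_unique[OF has_field_derivative_at_within[OF G'] l]) simp
  moreover have "m = r"
    by (rule has_field_derivative_unique[OF has_field_derivative_at_within[OF G'] r]) simp
  ultimately show False using lr by simp
qed

theorem theorem5p4:
  "(\<forall>f. pl_homeomorphism f \<and> orientation_preserving f \<longrightarrow>
      (f \<in> T_B \<longleftrightarrow>
         preserves_basilica_rel f \<and>
         (\<forall>p. breakpoint f p \<longrightarrow> (\<exists>A\<in>basilica_lamination. p \<in> A)))) \<and>
   group \<lparr>carrier = T_B, monoid.mult = (\<circ>), one = id\<rparr>"
proof (intro conjI allI impI)
  show "group \<lparr>carrier = T_B, monoid.mult = (\<circ>), one = id\<rparr>" by (rule T_B_group)
  fix f :: "circle \<Rightarrow> circle"
  assume f: "pl_homeomorphism f \<and> orientation_preserving f"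
  show "f \<in> T_B \<longleftrightarrow>
         preserves_basilica_rel f \<and>
         (\<forall>p. breakpoint f p \<longrightarrow> (\<exists>A\<in>basilica_lamination. p \<in> A))"
  proof
    assume T: "f \<in> T_B"
    then have "preserves_basilica_rel f" unfolding T_B_iff_basilica_map basilica_map_def by blast
    then show "preserves_basilica_rel f \<and>
         (\<forall>p. breakpoint f p \<longrightarrow> (\<exists>A\<in>basilica_lamination. p \<in> A))"
      using T_B_breakpoint[OF T] by blast
  next
    assume "preserves_basilica_rel f \<and>
         (\<forall>p. breakpoint f p \<longrightarrow> (\<exists>A\<in>basilica_lamination. p \<in> A))"
    then show "f \<in> T_B" unfolding T_B_iff_basilica_map using f by (intro basilica_mapI) blast+
  qed
qed

end
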